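(* Let $\mathcal{A}$ be a semiprime, complex, unital Banach algebra with $\mathrm{soc}(\mathcal{A})\neq\{0\}$, let $x\in\mathcal{A}$ and $\lambda_0\in\mathbb{C}$, and suppose that $x-\lambda_0$ is B-Fredholm. Then the following assertions are equivalent: (1) $x$ has left SVEP at $\lambda_0$; (2) $p_l(x-\lambda_0)<\infty$; (3) $q_r(x-\lambda_0)<\infty$; (4) $\sigma_l(x)$ does not cluster at $\lambda_0$; (5) $\lambda_0$ is not an interior point of $\sigma_l(x)$; (6) $H_l(x-\lambda_0)=R((x-\lambda_0)^p)$ for some $p\in\mathbb{N}$; (7) $H_l(x-\lambda_0)$ is closed; (8) $H_l(x-\lambda_0)\cap K_l(x-\lambda_0)=\{0\}$; (9) $H_l(x-\lambda_0)\cap K_l(x-\lambda_0)$ is closed; (10) $\bigcup_{n=1}^{\infty}R((x-\lambda_0)^n)\cap\bigcap_{n=1}^{\infty}(x-\lambda_0)^n\mathcal{A}=\{0\}$. In this case, if $p:=p_l(x-\lambda_0)$, then $$H_l(x-\lambda_0)=\bigcup_{n=1}^{\infty}R((x-\lambda_0)^n)=R((x-\lambda_0)^p).$$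
   Context: An algebra is semiprime if $\{0\}$ is its only two-sided ideal $J$ with $J^2=\{0\}$. $\mathrm{soc}(\mathcal{A})$ is the sum of all minimal right ideals of $\mathcal{A}$ (equal to the sum of all minimal left ideals), or $\{0\}$ if there are none. An element $a$ of a ring is Drazin invertible if there are $b$ in the ring and $k\in\mathbb{N}$ with $bab=b$, $ab=ba$, $a^kba=a^k$. An element $a\in\mathcal{A}$ is B-Fredholm if its image in $\mathcal{A}/\mathrm{soc}(\mathcal{A})$ is Drazin invertible. $x-\lambda$ means $x-\lambda 1$. $R(x)=\{a\in\mathcal{A}:xa=0\}$. $x$ has left SVEP (left single-valued extension property) at $\lambda\in\mathbb{C}$ if for every connected open neighbourhood $U$ of $\lambda$ the only holomorphic $f:U\to\mathcal{A}$ with $(\mu-x)f(\mu)=0$ for all $\mu\in U$ is $f\equiv0$. $L_x(a)=xa$ and $R_x(a)=ax$ are the multiplication operators on $\mathcal{A}$. For a bounded linear operator $T$ on a Banach space, the ascent is $p(T)=\inf\{n\ge 0:\ker T^n=\ker T^{n+1}\}$ and the descent is $q(T)=\inf\{n\geq 0:\mathrm{ran}\,T^n=\mathrm{ran}\,T^{n+1}\}$ (with $\inf\emptyset=\infty$). $p_l(x)=p(L_x)$ and $q_r(x)=q(R_x)$. $\sigma_l(x)=\{\lambda\in\mathbb{C}:x-\lambda\text{ is not left invertible}\}$ is the left spectrum. A set clusters at $\lambda_0$ if $\lambda_0$ is an accumulation point of it. $H_l(x)=\{a\in\mathcal{A}:\lim_{n\to\infty}\|x^na\|^{1/n}=0\}$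 (left quasinilpotent part). $K_l(x)$ (left analytical core) is the set of $a\in\mathcal{A}$ for which there exist a sequence $(a_n)_{n\ge1}$ in $\mathcal{A}$ and $\delta>0$ with $xa_1=a$, $xa_{n+1}=a_n$ and $\|a_n\|\le\delta^n\|a\|$ for all $n\ge 1$. *)

theory Defs
  imports "HOL-Analysis.Analysis" "HOL-Algebra.QuotRing" "HOL-Algebra.Ideal_Product"
begin

section \<open>Complex unital Banach algebras\<close>

class complex_banach_algebra_1 = real_normed_algebra_1 + banach +
  fixes scaleC :: "complex \<Rightarrow> 'a \<Rightarrow> 'a"  (infixr \<open>*\<^sub>C\<close> 75)
  assumes scaleC_add_right: "c *\<^sub>C (x + y) = c *\<^sub>C x + c *\<^sub>C y"
    and scaleC_add_left: "(c + d) *\<^sub>C x = c *\<^sub>C x + d *\<^sub>C x"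
    and scaleC_scaleC: "c *\<^sub>C (d *\<^sub>C x) = (c * d) *\<^sub>C x"
    and scaleR_scaleC: "r *\<^sub>R x = complex_of_real r *\<^sub>C x"
    and mult_scaleC_left: "(c *\<^sub>C x) * y = c *\<^sub>C (x * y)"
    and mult_scaleC_right: "x * (c *\<^sub>C y) = c *\<^sub>C (x * y)"
    and norm_scaleC: "norm (c *\<^sub>C x) = cmod c * norm x"

instantiation complex :: complex_banach_algebra_1
begin

definition scaleC_complex :: "complex \<Rightarrow> complex \<Rightarrow> complex"
  where "scaleC_complex c x = c * x"

instance
  by standard (simp_all add: scaleC_complex_def algebra_simps scaleR_conv_of_real norm_mult)

end


section \<open>Semiprime rings, the socle, Drazin invertibility\<close>

text \<open>
  In a unital algebra every one-sided or two-sided ring ideal is closed under scalar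
  multiplication, so the ring notions below coincide with the algebra notions.
\<close>

definition semiprime :: "('a, 'b) ring_scheme \<Rightarrow> bool"
  where "semiprime R \<longleftrightarrow> ring R \<and>
    (\<forall>J. ideal J R \<longrightarrow> ideal_prod R J J = {\<zero>\<^bsub>R\<^esub>} \<longrightarrow> J = {\<zero>\<^bsub>R\<^esub>})"

definition right_ideal :: "'a set \<Rightarrow> ('a, 'b) ring_scheme \<Rightarrow> bool"
  where "right_ideal I R \<longleftrightarrow>
    additive_subgroup I R \<and> (\<forall>a\<in>I. \<forall>r\<in>carrier R. a \<otimes>\<^bsub>R\<^esub> r \<in> I)"

definition minimal_right_ideal :: "'a set \<Rightarrow> ('a, 'b) ring_scheme \<Rightarrow> bool"
  where "minimal_right_ideal I R \<longleftrightarrow> right_ideal I R \<and> I \<noteq> {\<zero>\<^bsub>R\<^esub>} \<and>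
    (\<forall>J. right_ideal J R \<longrightarrow> J \<subseteq> I \<longrightarrow> J = {\<zero>\<^bsub>R\<^esub>} \<or> J = I)"

text \<open>
  The elements of the sum of the family of all minimal right ideals are the finite sums
  with at most one summand from each of them; if there are no minimal right ideals, only the
  empty sum \<open>\<zero>\<close> remains.
\<close>

definition socle :: "('a, 'b) ring_scheme \<Rightarrow> 'a set"
  where "socle R = {finsum R f F | f F.
    finite F \<and> (\<forall>I\<in>F. minimal_right_ideal I R \<and> f I \<in> I)}"

definition drazin_invertible :: "('a, 'b) ring_scheme \<Rightarrow> 'a \<Rightarrow> bool"
  where "drazin_invertible R a \<longleftrightarrow> a \<in> carrier R \<and>
    (\<exists>b\<in>carrier R. \<exists>k::nat.
      b \<otimes>\<^bsub>R\<^esub> a \<otimes>\<^bsub>R\<^esub> b = b \<and>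
      a \<otimes>\<^bsub>R\<^esub> b = b \<otimes>\<^bsub>R\<^esub> a \<and>
      a [^]\<^bsub>R\<^esub> k \<otimes>\<^bsub>R\<^esub> b \<otimes>\<^bsub>R\<^esub> a = a [^]\<^bsub>R\<^esub> k)"

definition algebra_ring :: "'a::ring_1 ring"
  where "algebra_ring = \<lparr>carrier = UNIV, mult = (*), one = 1, zero = 0, add = (+)\<rparr>"

lemma ring_algebra_ring: "ring (algebra_ring :: 'a::ring_1 ring)"
  by (rule ringI)
    (auto simp: algebra_ring_def algebra_simps intro!: abelian_groupI monoidI
      intro: exI[where P = "\<lambda>y. _ + y = 0", OF add.right_inverse])

definition B_Fredholm :: "'a::complex_banach_algebra_1 \<Rightarrow> bool"
  where "B_Fredholm a \<longleftrightarrow>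
    drazin_invertible (algebra_ring Quot socle algebra_ring)
      (socle algebra_ring +>\<^bsub>algebra_ring\<^esub> a)"


section \<open>Spectral notions\<close>

text \<open>
  Same pattern as \<^const>\<open>has_field_derivative\<close>, for functions with values in the algebra.
\<close>

definition banach_holomorphic_on ::
    "(complex \<Rightarrow> 'a::complex_banach_algebra_1) \<Rightarrow> complex set \<Rightarrow> bool"
  where "banach_holomorphic_on f U \<longleftrightarrow>
    (\<forall>z\<in>U. \<exists>D. (f has_derivative (\<lambda>h. h *\<^sub>C D)) (at z within U))"

definition left_SVEP :: "'a::complex_banach_algebra_1 \<Rightarrow> complex \<Rightarrow> bool"
  where "left_SVEP x l \<longleftrightarrow>
    (\<forall>U f. open U \<longrightarrow> connected U \<longrightarrow> l \<in> U \<longrightarrow> banach_holomorphic_on f U \<longrightarrow>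
      (\<forall>\<mu>\<in>U. (\<mu> *\<^sub>C 1 - x) * f \<mu> = 0) \<longrightarrow> (\<forall>\<mu>\<in>U. f \<mu> = 0))"

text \<open>In \<^typ>\<open>enat\<close> the infimum of the empty set is \<open>\<infinity>\<close>.\<close>

definition ascent :: "('a::zero \<Rightarrow> 'a) \<Rightarrow> enat"
  where "ascent T = Inf {enat n | n. {a. (T ^^ n) a = 0} = {a. (T ^^ (n + 1)) a = 0}}"

definition descent :: "('a \<Rightarrow> 'a) \<Rightarrow> enat"
  where "descent T = Inf {enat n | n. range (T ^^ n) = range (T ^^ (n + 1))}"

definition left_ascent :: "'a::complex_banach_algebra_1 \<Rightarrow> enat"
  where "left_ascent x = ascent (\<lambda>a. x * a)"

definition right_descent :: "'a::complex_banach_algebra_1 \<Rightarrow> enat"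
  where "right_descent x = descent (\<lambda>a. a * x)"

definition left_spectrum :: "'a::complex_banach_algebra_1 \<Rightarrow> complex set"
  where "left_spectrum x = {l. \<not> (\<exists>y. y * (x - l *\<^sub>C 1) = 1)}"

definition right_annihilator :: "'a::complex_banach_algebra_1 \<Rightarrow> 'a set"
  where "right_annihilator x = {a. x * a = 0}"

definition left_quasinilpotent_part :: "'a::complex_banach_algebra_1 \<Rightarrow> 'a set"
  where "left_quasinilpotent_part x = {a. (\<lambda>n. root n (norm (x ^ n * a))) \<longlonglongrightarrow> 0}"

definition left_analytical_core :: "'a::complex_banach_algebra_1 \<Rightarrow> 'a set"
  where "left_analytical_core x = {a. \<exists>(s :: nat \<Rightarrow> 'a) (\<delta> :: real). \<delta> > 0 \<and> x * s 1 = a \<and>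
    (\<forall>n\<ge>1. x * s (n + 1) = s n \<and> norm (s n) \<le> \<delta> ^ n * norm a)}"

end

theory Submission
  imports Defs "HOL-Complex_Analysis.Conformal_Mappings"
begin

text \<open>
  Put \<open>t = x - l0\<close>. In a semiprime ring every right ideal contained in a finite sum of minimal right
  ideals is generated by an idempotent, and such right ideals satisfy the descending chain condition.
  Hence elements of the socle are von Neumann regular, and since \<open>t\<close> is Drazin invertible modulo the
  socle, all high powers \<open>t ^ n\<close> are regular and the right ideals \<open>ker t \<inter> t ^ n A\<close> are eventually constant.

  If the ascent is finite, regularity gives \<open>y t ^ (n + 1) = t ^ n\<close>. A Neumann series then makes
  \<open>t - \<mu>\<close> left invertible for small \<open>\<mu> \<noteq> 0\<close>, and \<open>norm (t ^ n a) \<le> norm y ^ m * norm (t ^ (n + m) a)\<close>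
  forces the quasinilpotent part into \<open>ker (t ^ n)\<close>.

  If the ascent is infinite, there is \<open>a \<noteq> 0\<close> in \<open>ker t \<inter> M\<close>, where \<open>M\<close> is the intersection of all
  \<open>t ^ n A\<close>, and there is \<open>v\<close> with \<open>t v h = h\<close> for all \<open>h\<close> in \<open>M\<close>. The vectors
  \<open>H \<mu> = \<Sum>n. \<mu> ^ n v ^ n a\<close> are nonzero, depend holomorphically on \<open>\<mu>\<close> and satisfy
  \<open>t (H \<mu>) = \<mu> (H \<mu>)\<close>, and their partial sums are annihilated by powers of \<open>t\<close>; this refutes each
  of the other conditions.
\<close>

section \<open>Right ideals and the socle\<close>

lemma algebra_ring_simps [simp]:
  "carrier algebra_ring = UNIV" "x \<otimes>\<^bsub>algebra_ring\<^esub> y = x * y" "x \<oplus>\<^bsub>algebra_ring\<^esub> y = x + y"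
  "\<one>\<^bsub>algebra_ring\<^esub> = 1" "\<zero>\<^bsub>algebra_ring\<^esub> = 0"
  by (simp_all add: algebra_ring_def)

lemma algebra_ring_uminus [simp]: "\<ominus>\<^bsub>algebra_ring\<^esub> x = - (x::'a::ring_1)"
proof -
  interpret ring "algebra_ring :: 'a ring" by (rule ring_algebra_ring)
  show ?thesis using minus_equality[of "- x" x] by simp
qed

lemma algebra_ring_pow [simp]: "x [^]\<^bsub>algebra_ring\<^esub> (n::nat) = (x::'a::ring_1) ^ n"
proof -
  interpret ring "algebra_ring :: 'a ring" by (rule ring_algebra_ring)
  show ?thesis by (induction n) (simp_all add: power_commutes)
qed

lemma algebra_ring_finsum: "finite F \<Longrightarrow> finsum algebra_ring f F = (sum f F :: 'a::ring_1)"
proof (induction F rule: finite_induct)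
  interpret ring "algebra_ring :: 'a ring" by (rule ring_algebra_ring)
  case empty
  show ?case using finsum_empty[of f] by simp
next
  interpret ring "algebra_ring :: 'a ring" by (rule ring_algebra_ring)
  case (insert x F)
  then show ?case using finsum_insert[of F x f] by simp
qed

lemma additive_subgroup_algebra_ring:
  "additive_subgroup I algebra_ring \<longleftrightarrow>
    (0::'a::ring_1) \<in> I \<and> (\<forall>a\<in>I. \<forall>b\<in>I. a + b \<in> I) \<and> (\<forall>a\<in>I. - a \<in> I)"
proof -
  interpret ring "algebra_ring :: 'a ring" by (rule ring_algebra_ring)
  have "inv\<^bsub>add_monoid algebra_ring\<^esub> a = - a" for a :: 'a
    using algebra_ring_uminus[of a] by (simp add: a_inv_def)
  then show ?thesis
    by (auto simp: additive_subgroup_def subgroup_def)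
qed

lemma right_ideal_algebra_ring:
  "right_ideal I algebra_ring \<longleftrightarrow>
    (0::'a::ring_1) \<in> I \<and> (\<forall>a\<in>I. \<forall>b\<in>I. a + b \<in> I) \<and> (\<forall>a\<in>I. \<forall>r. a * r \<in> I)"
proof -
  have "- a \<in> I" if "\<forall>a\<in>I. \<forall>r. a * r \<in> I" "a \<in> I" for a
    using that by (metis mult_minus1_right)
  then show ?thesis
    by (auto simp: right_ideal_def additive_subgroup_algebra_ring)
qed

section \<open>Closure properties of right ideals\<close>

abbreviation is_right_ideal :: "'a::ring_1 set \<Rightarrow> bool"
  where "is_right_ideal I \<equiv> right_ideal I algebra_ring"

abbreviation is_minimal_right_ideal :: "'a::ring_1 set \<Rightarrow> bool"
  where "is_minimal_right_ideal I \<equiv> minimal_right_ideal I algebra_ring"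

lemma right_ideal_zero: "is_right_ideal I \<Longrightarrow> 0 \<in> I"
  and right_ideal_add: "is_right_ideal I \<Longrightarrow> a \<in> I \<Longrightarrow> b \<in> I \<Longrightarrow> a + b \<in> I"
  and right_ideal_mult: "is_right_ideal I \<Longrightarrow> a \<in> I \<Longrightarrow> a * r \<in> I"
  by (auto simp: right_ideal_algebra_ring)

lemma right_ideal_uminus: "is_right_ideal I \<Longrightarrow> a \<in> I \<Longrightarrow> - a \<in> I"
  using right_ideal_mult[of I a "- 1"] by simp

lemma right_ideal_diff: "is_right_ideal I \<Longrightarrow> a \<in> I \<Longrightarrow> b \<in> I \<Longrightarrow> a - b \<in> I"
  using right_ideal_add[of I a "- b"] by (simp add: right_ideal_uminus)

lemma right_ideal_singleton_zero: "is_right_ideal {0}"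
  by (auto simp: right_ideal_algebra_ring)

lemma right_ideal_right_annihilator: "is_right_ideal {a. c * a = 0}"
  by (auto simp: right_ideal_algebra_ring distrib_left mult.assoc[symmetric])

lemma right_ideal_Int: "is_right_ideal I \<Longrightarrow> is_right_ideal J \<Longrightarrow> is_right_ideal (I \<inter> J)"
  by (auto simp: right_ideal_algebra_ring)

lemma right_ideal_image_mult:
  assumes I: "is_right_ideal I"
  shows "is_right_ideal ((*) c ` I)"
proof (unfold right_ideal_algebra_ring, intro conjI ballI allI)
  show "0 \<in> (*) c ` I" using right_ideal_zero[OF I] by (intro image_eqI[of _ _ 0]) auto
  fix a assume "a \<in> (*) c ` I"
  then obtain p where p: "a = c * p" "p \<in> I" by blast
  show "a * r \<in> (*) c ` I" for r
    using p right_ideal_mult[OF I p(2)] by (intro image_eqI[of _ _ "p * r"]) (auto simp: mult.assoc)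
  fix b assume "b \<in> (*) c ` I"
  then obtain q where q: "b = c * q" "q \<in> I" by blast
  show "a + b \<in> (*) c ` I"
    using p q right_ideal_add[OF I p(2) q(2)]
    by (intro image_eqI[of _ _ "p + q"]) (auto simp: distrib_left)
qed

lemma right_ideal_range_mult: "is_right_ideal (range ((*) c))"
  by (rule right_ideal_image_mult) (simp add: right_ideal_algebra_ring)

definition ideal_plus :: "'a::ring_1 set \<Rightarrow> 'a set \<Rightarrow> 'a set"
  where "ideal_plus J I = {j + i | j i. j \<in> J \<and> i \<in> I}"

lemma ideal_plusI: "j \<in> J \<Longrightarrow> i \<in> I \<Longrightarrow> j + i \<in> ideal_plus J I"
  unfolding ideal_plus_def by blast

lemma ideal_plusE:
  assumes "a \<in> ideal_plus J I"
  obtains j i where "a = j + i" "j \<in> J" "i \<in> I"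
  using assms unfolding ideal_plus_def by blast

lemma right_ideal_plus:
  assumes J: "is_right_ideal J" and I: "is_right_ideal I"
  shows "is_right_ideal (ideal_plus J I)"
proof (unfold right_ideal_algebra_ring, intro conjI ballI allI)
  show "0 \<in> ideal_plus J I"
    using ideal_plusI[OF right_ideal_zero[OF J] right_ideal_zero[OF I]] by simp
  fix a assume "a \<in> ideal_plus J I"
  then obtain j i where a: "a = j + i" "j \<in> J" "i \<in> I" by (rule ideal_plusE)
  show "a * r \<in> ideal_plus J I" for r
    using ideal_plusI[OF right_ideal_mult[OF J a(2)] right_ideal_mult[OF I a(3)]]
    by (simp add: a(1) distrib_right)
  fix b assume "b \<in> ideal_plus J I"
  then obtain j' i' where b: "b = j' + i'" "j' \<in> J" "i' \<in> I" by (rule ideal_plusE)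
  show "a + b \<in> ideal_plus J I"
    using ideal_plusI[OF right_ideal_add[OF J a(2) b(2)] right_ideal_add[OF I a(3) b(3)]]
    by (simp add: a(1) b(1) algebra_simps)
qed

section \<open>Minimal right ideals and their sums\<close>

lemma minimalD:
  assumes "is_minimal_right_ideal I"
  shows "is_right_ideal I" "I \<noteq> {0}" "is_right_ideal J \<Longrightarrow> J \<subseteq> I \<Longrightarrow> J \<noteq> {0} \<Longrightarrow> J = I"
  using assms by (auto simp: minimal_right_ideal_def)

lemma minimalI:
  assumes "is_right_ideal I" "I \<noteq> {0}" "\<And>J. is_right_ideal J \<Longrightarrow> J \<subseteq> I \<Longrightarrow> J \<noteq> {0} \<Longrightarrow> I \<subseteq> J"
  shows "is_minimal_right_ideal I"
  using assms unfolding minimal_right_ideal_def by auto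

text \<open>The preimage in \<open>I\<close> of a nonzero right ideal \<open>J\<close> inside
  \<open>c I\<close> is a nonzero right ideal, so by minimality it is all of \<open>I\<close>. This
  will make the socle stable under multiplication from the left.\<close>

lemma minimal_image_mult:
  assumes I: "is_minimal_right_ideal I"
  shows "(*) c ` I = {0} \<or> is_minimal_right_ideal ((*) c ` I)"
proof (rule disjCI)
  assume "\<not> is_minimal_right_ideal ((*) c ` I)"
  note ri = minimalD(1)[OF I]
  show "(*) c ` I = {0}"
  proof (rule ccontr)
    assume nz: "(*) c ` I \<noteq> {0}"
    have "is_minimal_right_ideal ((*) c ` I)"
    proof (rule minimalI[OF right_ideal_image_mult[OF ri] nz])
      fix J assume J: "is_right_ideal J" "J \<subseteq> (*) c ` I" "J \<noteq> {0}"
      define K where "K = {i \<in> I. c * i \<in> J}"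
      have "is_right_ideal K"
        using ri J(1) by (auto simp: K_def right_ideal_algebra_ring distrib_left mult.assoc[symmetric])
      moreover have "K \<noteq> {0}"
      proof -
        obtain j where "j \<in> J" "j \<noteq> 0" using J(1,3) right_ideal_zero by blast
        moreover obtain i where "i \<in> I" "j = c * i" using J(2) \<open>j \<in> J\<close> by blast
        ultimately have "i \<in> K" "i \<noteq> 0" by (auto simp: K_def)
        then show ?thesis by blast
      qed
      ultimately have "K = I" using minimalD(3)[OF I] by (auto simp: K_def)
      then show "(*) c ` I \<subseteq> J" by (auto simp: K_def)
    qed
    then show False using \<open>\<not> is_minimal_right_ideal ((*) c ` I)\<close> by contradiction
  qed
qed

text \<open>Summands are added one at a time so that induction only has to treat a single minimal
  right ideal. The sums need not be direct.\<close>

inductive sum_of_minimal :: "'a::ring_1 set \<Rightarrow> bool" where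
  zero: "sum_of_minimal {0}"
| plus: "sum_of_minimal J \<Longrightarrow> is_minimal_right_ideal I \<Longrightarrow> sum_of_minimal (ideal_plus J I)"

lemma sum_of_minimal_right_ideal: "sum_of_minimal J \<Longrightarrow> is_right_ideal J"
  by (induction rule: sum_of_minimal.induct)
    (auto intro: right_ideal_singleton_zero right_ideal_plus minimalD(1))

section \<open>The socle as a two-sided ideal\<close>

lemma socle_eq:
  "socle algebra_ring = {sum f F | f F. finite F \<and> (\<forall>I\<in>F. is_minimal_right_ideal I \<and> f I \<in> (I::'a::ring_1 set))}"
  unfolding socle_def by (auto simp: algebra_ring_finsum; metis algebra_ring_finsum)

lemma socle_in_sum_of_minimal:
  assumes "s \<in> socle (algebra_ring :: 'a::ring_1 ring)"
  shows "\<exists>J. sum_of_minimal J \<and> s \<in> J"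
proof -
  have "\<exists>J. sum_of_minimal J \<and> sum f F \<in> J"
    if "finite F" "\<forall>I\<in>F. is_minimal_right_ideal I \<and> f I \<in> (I::'a set)" for f F
    using that
  proof (induction F rule: finite_induct)
    case empty
    then show ?case using sum_of_minimal.zero by auto
  next
    case (insert I F)
    then obtain J where J: "sum_of_minimal J" "sum f F \<in> J" by auto
    then have "sum_of_minimal (ideal_plus J I)"
      using insert.prems by (simp add: sum_of_minimal.plus)
    moreover have "sum f (insert I F) \<in> ideal_plus J I"
      using ideal_plusI[OF J(2), of "f I" I] insert by (simp add: add.commute)
    ultimately show ?case by blast
  qed
  with assms show ?thesis unfolding socle_eq by blast
qed

lemma socle_zero: "0 \<in> socle (algebra_ring :: 'a::ring_1 ring)"
  unfolding socle_eq by (auto intro!: exI[of _ "{}"])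

lemma socle_add:
  fixes a b :: "'a::ring_1"
  assumes "a \<in> socle algebra_ring" "b \<in> socle algebra_ring"
  shows "a + b \<in> socle algebra_ring"
proof -
  obtain f F where f: "a = sum f F" "finite F" "\<forall>I\<in>F. is_minimal_right_ideal I \<and> f I \<in> I"
    using assms(1) unfolding socle_eq by blast
  obtain g G where g: "b = sum g G" "finite G" "\<forall>I\<in>G. is_minimal_right_ideal I \<and> g I \<in> I"
    using assms(2) unfolding socle_eq by blast
  \<comment> \<open>The same minimal ideal may occur in both families, while the socle is described
    with one summand per ideal; the contributions are therefore merged, with 0 outside the index
    sets.\<close>
  define h where "h I = (if I \<in> F then f I else 0) + (if I \<in> G then g I else 0)" for I
  have "sum h (F \<union> G) = a + b"
    unfolding h_def sum.distrib f(1) g(1)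
    using f(2) g(2) sum.inter_restrict[of "F \<union> G" f F] sum.inter_restrict[of "F \<union> G" g G]
    by (simp add: Int_absorb1)
  moreover have "\<forall>I\<in>F \<union> G. is_minimal_right_ideal I \<and> h I \<in> I"
    using f(3) g(3) minimalD(1) unfolding h_def by (auto intro: right_ideal_add)
  ultimately show ?thesis
    unfolding socle_eq using f(2) g(2) by (intro CollectI exI[of _ h] exI[of _ "F \<union> G"]) simp
qed

lemma minimal_subset_socle: "is_minimal_right_ideal I \<Longrightarrow> I \<subseteq> socle (algebra_ring :: 'a::ring_1 ring)"
proof
  fix a assume "is_minimal_right_ideal I" "a \<in> I"
  then show "a \<in> socle algebra_ring"
    unfolding socle_eq by (intro CollectI exI[of _ "\<lambda>_. a"] exI[of _ "{I}"]) simp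
qed

lemma sum_of_minimal_subset_socle:
  "sum_of_minimal J \<Longrightarrow> J \<subseteq> socle (algebra_ring :: 'a::ring_1 ring)"
proof (induction rule: sum_of_minimal.induct)
  case zero
  then show ?case by (simp add: socle_zero)
next
  case (plus J I)
  then show ?case using minimal_subset_socle[of I] by (auto simp: ideal_plus_def intro: socle_add)
qed

lemma socle_mult_right: "s \<in> socle (algebra_ring :: 'a::ring_1 ring) \<Longrightarrow> s * r \<in> socle algebra_ring"
  using socle_in_sum_of_minimal sum_of_minimal_subset_socle sum_of_minimal_right_ideal right_ideal_mult
  by blast

text \<open>Left multiplication by \<open>r\<close> carries each minimal right ideal to zero or to
  another minimal right ideal, so every summand stays in the socle.\<close>

lemma socle_mult_left:
  fixes s :: "'a::ring_1"
  assumes "s \<in> socle algebra_ring"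
  shows "r * s \<in> socle algebra_ring"
proof -
  obtain f F where f: "s = sum f F" "finite F" "\<forall>I\<in>F. is_minimal_right_ideal I \<and> f I \<in> I"
    using assms unfolding socle_eq by blast
  have "r * f I \<in> socle algebra_ring" if "I \<in> F" for I
  proof -
    have I: "is_minimal_right_ideal I" "r * f I \<in> (*) r ` I" using f(3) that by auto
    show ?thesis
    proof (cases "(*) r ` I = {0}")
      case True
      then show ?thesis using I(2) socle_zero by simp
    next
      case False
      then have "(*) r ` I \<subseteq> socle algebra_ring"
        using minimal_image_mult[OF I(1), of r] minimal_subset_socle by simp
      then show ?thesis using I(2) by (rule subsetD)
    qed
  qed
  with f(2) have "(\<Sum>I\<in>F. r * f I) \<in> socle algebra_ring"
    by (induction F rule: finite_induct) (auto intro: socle_zero socle_add)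
  then show ?thesis by (simp add: f(1) sum_distrib_left)
qed

lemma ideal_socle: "ideal (socle algebra_ring) (algebra_ring :: 'a::ring_1 ring)"
proof (rule ideal.intro)
  show "additive_subgroup (socle algebra_ring) (algebra_ring :: 'a ring)"
    unfolding additive_subgroup_algebra_ring
    using socle_zero socle_add socle_mult_right[of _ "- 1"] by auto
  show "ideal_axioms (socle algebra_ring) (algebra_ring :: 'a ring)"
    by (simp add: ideal_axioms_def socle_mult_left socle_mult_right)
qed (rule ring_algebra_ring)

section \<open>Right ideals inside the socle of a semiprime ring\<close>

text \<open>If \<open>s A s = 0\<close>, the ideal \<open>J\<close> generated by \<open>s\<close>
  squares to zero: the vanishing is extended from \<open>s\<close> to \<open>J\<close> in one factor
  at a time, by exhibiting ideals that contain \<open>s\<close>.\<close>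

lemma semiprime_elementwise:
  fixes s :: "'a::ring_1"
  assumes "semiprime (algebra_ring :: 'a ring)" and s: "\<And>a. s * a * s = 0"
  shows "s = 0"
proof -
  define J where "J = genideal algebra_ring {s}"
  interpret ring "algebra_ring :: 'a ring" by (rule ring_algebra_ring)
  have J: "ideal J algebra_ring" unfolding J_def by (rule genideal_ideal) simp
  have sJ: "s \<in> J" unfolding J_def using genideal_self[of "{s}"] by auto
  \<comment> \<open>Right factor: \<open>L\<close> is a two-sided ideal containing \<open>s\<close>,
    hence containing \<open>J\<close>, so \<open>s A J = 0\<close>.\<close>
  define L where "L = {z. \<forall>a. s * a * z = 0}"
  have "s * a * (b * z) = 0" if "\<forall>a. s * a * z = 0" for a b z
    using that[rule_format, of "a * b"] by (simp add: mult.assoc)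
  moreover have "s * a * (z * b) = 0" if "\<forall>a. s * a * z = 0" for a b z
    using that by (simp add: mult.assoc[symmetric])
  ultimately have "ideal L algebra_ring"
    by (intro ideal.intro[OF _ ring_algebra_ring])
      (auto simp: L_def additive_subgroup_algebra_ring ideal_axioms_def distrib_left)
  moreover have "s \<in> L" using s by (simp add: L_def)
  ultimately have JL: "J \<subseteq> L" unfolding J_def by (intro genideal_minimal) auto
  \<comment> \<open>Left factor: by the previous inclusion \<open>s\<close> lies in the ideal
    \<open>M\<close>, hence so does \<open>J\<close>, and \<open>J A J = 0\<close>.\<close>
  define M where "M = {y. \<forall>z\<in>J. \<forall>a. y * a * z = 0}"
  have "b * y * a * z = 0" if "\<forall>z\<in>J. \<forall>a. y * a * z = 0" "z \<in> J" for a b y z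
    using that by (simp add: mult.assoc)
  moreover have "y * b * a * z = 0" if "\<forall>z\<in>J. \<forall>a. y * a * z = 0" "z \<in> J" for a b y z
    using that(1)[rule_format, OF that(2), of "b * a"] by (simp add: mult.assoc)
  ultimately have "ideal M algebra_ring"
    by (intro ideal.intro[OF _ ring_algebra_ring])
      (auto simp: M_def additive_subgroup_algebra_ring ideal_axioms_def distrib_right)
  moreover have "s \<in> M" using JL by (auto simp: M_def L_def)
  ultimately have JM: "J \<subseteq> M" unfolding J_def by (intro genideal_minimal) auto
  have JJ0: "y * z = 0" if "y \<in> J" "z \<in> J" for y z
    using JM that unfolding M_def by (metis (mono_tags, lifting) mem_Collect_eq mult.right_neutral subsetD)
  have "w = 0" if "w \<in> ideal_prod algebra_ring J J" for w
    using that by (induction rule: ideal_prod.induct) (auto simp: JJ0)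
  moreover have "0 \<in> ideal_prod algebra_ring J J"
    using ideal_prod.prod[OF sJ sJ, of algebra_ring] JJ0[OF sJ sJ] by simp
  ultimately have "ideal_prod algebra_ring J J = {0}" by blast
  then have "J = {0}" using assms(1) J by (simp add: semiprime_def)
  then show ?thesis using sJ by simp
qed

text \<open>Brauer's lemma. Semiprimeness provides \<open>u\<close> in \<open>I\<close> with
  \<open>u I\<close> nonzero; then \<open>u I = I\<close>, and left multiplication by
  \<open>u\<close> is injective on \<open>I\<close>, which forces a solution \<open>e\<close> in
  \<open>I\<close> of \<open>u * e = u\<close> to be idempotent.\<close>

lemma minimal_generated_by_idempotent:
  assumes sp: "semiprime (algebra_ring :: 'a::ring_1 ring)" and I: "is_minimal_right_ideal (I :: 'a set)"
  shows "\<exists>e. e * e = e \<and> I = range ((*) e)"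
proof -
  note ri = minimalD(1)[OF I]
  obtain s where s: "s \<in> I" "s \<noteq> 0" using minimalD(2)[OF I] right_ideal_zero[OF ri] by blast
  obtain a where a: "s * a * s \<noteq> 0" using semiprime_elementwise[OF sp] s(2) by blast
  define u where "u = s * a"
  have u: "u \<in> I" using right_ideal_mult[OF ri s(1)] by (simp add: u_def)
  have "is_right_ideal ((*) u ` I)" by (rule right_ideal_image_mult[OF ri])
  moreover have "(*) u ` I \<subseteq> I" using right_ideal_mult[OF ri u] by auto
  moreover have "(*) u ` I \<noteq> {0}" using a s(1) by (auto simp: u_def)
  ultimately have "(*) u ` I = I" by (rule minimalD(3)[OF I])
  then obtain e where e: "e \<in> I" "u * e = u" using u by (metis imageE)
  define K where "K = I \<inter> {i. u * i = 0}"
  have "is_right_ideal K"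
    unfolding K_def by (rule right_ideal_Int[OF ri right_ideal_right_annihilator])
  moreover have "s \<notin> K" using a by (simp add: K_def u_def)
  ultimately have "K = {0}" using minimalD(3)[OF I, of K] s(1) by (auto simp: K_def)
  moreover have "e * e - e \<in> K"
    using right_ideal_diff[OF ri right_ideal_mult[OF ri e(1)] e(1)] e(2)
    by (simp add: K_def right_diff_distrib mult.assoc[symmetric])
  ultimately have ee: "e * e = e" by simp
  have "e \<noteq> 0" using e(2) a by (auto simp: u_def)
  then have "range ((*) e) \<noteq> {0}" using ee by (metis rangeI singletonD)
  then have "range ((*) e) = I"
    using minimalD(3)[OF I right_ideal_range_mult] right_ideal_mult[OF ri e(1)] by blast
  with ee show ?thesis by blast
qed

lemma idempotent_range_iff:
  fixes a e :: "'a::ring_1"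
  assumes "e * e = e"
  shows "a \<in> range ((*) e) \<longleftrightarrow> e * a = a"
proof
  assume "a \<in> range ((*) e)"
  then obtain b where "a = e * b" by blast
  then show "e * a = a" using assms by (simp add: mult.assoc[symmetric])
next
  assume "e * a = a"
  then show "a \<in> range ((*) e)" by (intro image_eqI[of _ _ a]) auto
qed

lemma sum_of_idempotent_ideals:
  fixes e g :: "'a::ring_1"
  assumes "e * e = e" "g * g = g" "e * g = 0"
  shows "\<exists>h. h * h = h \<and> ideal_plus (range ((*) e)) (range ((*) g)) = range ((*) h)"
proof (intro exI conjI)
  \<comment> \<open>Only one product of the idempotents is known to vanish, so \<open>e + g\<close>
    need not be idempotent; subtracting \<open>g * e\<close> makes \<open>h\<close> a left identity
    for both \<open>e\<close> and \<open>g\<close>.\<close>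
  define h where "h = e + g - g * e"
  have he: "h * e = e" and hg: "h * g = g"
    using assms by (simp_all add: h_def algebra_simps mult.assoc)
  show hh: "h * h = h"
  proof -
    have "h * (e + g - g * e) = e + g - g * e"
      by (simp add: distrib_left right_diff_distrib mult.assoc[symmetric] he hg)
    then show ?thesis by (simp only: h_def[symmetric])
  qed
  show "ideal_plus (range ((*) e)) (range ((*) g)) = range ((*) h)"
  proof (rule equalityI; rule subsetI)
    fix a assume "a \<in> ideal_plus (range ((*) e)) (range ((*) g))"
    then obtain p q where "a = e * p + g * q" by (auto simp: ideal_plus_def)
    then have "h * a = a" by (simp add: distrib_left mult.assoc[symmetric] he hg)
    then show "a \<in> range ((*) h)" by (metis rangeI)
  next
    fix a assume "a \<in> range ((*) h)"
    then obtain b where "a = h * b" by auto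
    then have "a = e * b + g * (b - e * b)" by (simp add: h_def algebra_simps)
    then show "a \<in> ideal_plus (range ((*) e)) (range ((*) g))" unfolding ideal_plus_def by blast
  qed
qed

text \<open>Modulo \<open>J\<close>, a right ideal inside \<open>J + I\<close> with \<open>I\<close> minimal is zero or everything.\<close>

lemma right_ideal_in_plus_minimal:
  assumes J: "is_right_ideal J" and I: "is_minimal_right_ideal I" and N: "is_right_ideal N" "N \<subseteq> ideal_plus J I" "\<not> N \<subseteq> J"
  shows "ideal_plus J I \<subseteq> ideal_plus J N"
proof -
  note ri = minimalD(1)[OF I]
  \<comment> \<open>An element of \<open>N\<close> outside \<open>J\<close> has a nonzero
    \<open>I\<close>-component, and that component lies in \<open>J + N\<close>; so \<open>K\<close>
    is nonzero and minimality gives \<open>K = I\<close>.\<close>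
  define K where "K = I \<inter> ideal_plus J N"
  have "is_right_ideal K" unfolding K_def by (intro right_ideal_Int right_ideal_plus J N ri)
  moreover have "K \<noteq> {0}"
  proof -
    obtain n where n: "n \<in> N" "n \<notin> J" using N(3) by blast
    then obtain j i where ji: "n = j + i" "j \<in> J" "i \<in> I" using N(2) by (auto simp: ideal_plus_def)
    then have "i = - j + n" by simp
    then have "i \<in> K"
      using ji n right_ideal_uminus[OF J] unfolding K_def ideal_plus_def by blast
    moreover have "i \<noteq> 0" using ji n by auto
    ultimately show ?thesis by blast
  qed
  ultimately have IK: "I \<subseteq> ideal_plus J N" using minimalD(3)[OF I, of K] by (auto simp: K_def)
  show ?thesis
  proof
    fix a assume "a \<in> ideal_plus J I"
    then obtain j i where a: "a = j + i" "j \<in> J" "i \<in> I" by (auto simp: ideal_plus_def)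
    then obtain j' n where "i = j' + n" "j' \<in> J" "n \<in> N" using IK by (auto simp: ideal_plus_def)
    with a show "a \<in> ideal_plus J N"
      unfolding ideal_plus_def using right_ideal_add[OF J] by (auto simp: add.assoc[symmetric])
  qed
qed

text \<open>Induction on the summands. The part of \<open>N\<close> inside \<open>J\<close> is
  \<open>e A\<close> by induction; its complement \<open>Q\<close> in \<open>N\<close>, cut out by
  \<open>e\<close>, meets \<open>J\<close> trivially, so it is zero or minimal and is generated by
  an idempotent as well. The two idempotents are then combined.\<close>

lemma right_ideal_in_sum_of_minimal:
  assumes sp: "semiprime (algebra_ring :: 'a::ring_1 ring)" and "sum_of_minimal J"
    and "is_right_ideal N" "N \<subseteq> (J :: 'a set)"
  shows "\<exists>e. e * e = e \<and> N = range ((*) e)"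
  using assms(2-)
proof (induction J arbitrary: N rule: sum_of_minimal.induct)
  case zero
  then have "N = range ((*) 0)" using right_ideal_zero by auto
  then show ?case by (intro exI[of _ 0]) simp
next
  case (plus J I)
  note J = sum_of_minimal_right_ideal[OF plus.hyps(1)] and N = plus.prems
  obtain e where e: "e * e = e" "N \<inter> J = range ((*) e)"
    using plus.IH[OF right_ideal_Int[OF N(1) J]] by blast
  then have eN: "e \<in> N" "e \<in> J" by (metis IntD1 rangeI, metis IntD2 rangeI)
  define Q where "Q = N \<inter> {a. e * a = 0}"
  have Q: "is_right_ideal Q"
    unfolding Q_def by (rule right_ideal_Int[OF N(1) right_ideal_right_annihilator])
  have QJ: "a = 0" if "a \<in> Q" "a \<in> J" for a
    using that e idempotent_range_iff[OF e(1), of a] by (auto simp: Q_def)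
  have NQ: "N = ideal_plus (range ((*) e)) Q"
  proof (rule equalityI; rule subsetI)
    fix a assume a: "a \<in> N"
    have "a - e * a \<in> Q"
      using right_ideal_diff[OF N(1) a right_ideal_mult[OF N(1) eN(1)]] e(1)
      by (simp add: Q_def right_diff_distrib mult.assoc[symmetric])
    moreover have "a = e * a + (a - e * a)" by simp
    ultimately show "a \<in> ideal_plus (range ((*) e)) Q" unfolding ideal_plus_def by blast
  next
    fix a assume "a \<in> ideal_plus (range ((*) e)) Q"
    then show "a \<in> N"
      using right_ideal_add[OF N(1)] right_ideal_mult[OF N(1) eN(1)] by (auto simp: ideal_plus_def Q_def)
  qed
  have "Q = {0} \<or> is_minimal_right_ideal Q"
  proof (cases "Q = {0}")
    case False
    with Q have "is_minimal_right_ideal Q"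
    proof (rule minimalI)
      \<comment> \<open>As \<open>P\<close> is not inside \<open>J\<close>, the sum
        \<open>J + P\<close> already contains \<open>Q\<close>; the \<open>J\<close>-component of an
        element of \<open>Q\<close> then lies in both \<open>Q\<close> and \<open>J\<close> and
        vanishes.\<close>
      fix P assume P: "is_right_ideal P" "P \<subseteq> Q" "P \<noteq> {0}"
      then have "\<not> P \<subseteq> J" using QJ right_ideal_zero[OF P(1)] by blast
      moreover have "P \<subseteq> ideal_plus J I" using P(2) N(2) by (auto simp: Q_def)
      ultimately have sub: "ideal_plus J I \<subseteq> ideal_plus J P"
        by (intro right_ideal_in_plus_minimal J plus.hyps P)
      show "Q \<subseteq> P"
      proof
        fix q assume q: "q \<in> Q"
        then have "q \<in> ideal_plus J P" using sub N(2) by (auto simp: Q_def)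
        then obtain j p where jp: "q = j + p" "j \<in> J" "p \<in> P" by (auto simp: ideal_plus_def)
        then have "j = q - p" by simp
        then have "j \<in> Q" using right_ideal_diff[OF Q q] jp(3) P(2) by blast
        then show "q \<in> P" using QJ[of j] jp by simp
      qed
    qed
    then show ?thesis ..
  qed simp
  then obtain g where g: "g * g = g" "Q = range ((*) g)"
  proof
    assume "Q = {0}"
    then show ?thesis using that[of 0] by auto
  next
    assume "is_minimal_right_ideal Q"
    then show ?thesis using minimal_generated_by_idempotent[OF sp] that by blast
  qed
  have "g \<in> Q" using g by (simp add: idempotent_range_iff)
  then have "e * g = 0" by (simp add: Q_def)
  then show ?case using sum_of_idempotent_ideals[OF e(1) g(1)] NQ g(2) by simp
qed

text \<open>Writing \<open>s A = e A\<close> with \<open>e\<close> idempotent, one has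
  \<open>e = s * z\<close> for some \<open>z\<close>, and \<open>e\<close> fixes \<open>s\<close>
  from the left.\<close>

lemma socle_regular:
  assumes sp: "semiprime (algebra_ring :: 'a::ring_1 ring)" and s: "s \<in> socle (algebra_ring :: 'a ring)"
  shows "\<exists>z. s * z * s = s"
proof -
  obtain J where J: "sum_of_minimal J" "s \<in> J" using socle_in_sum_of_minimal[OF s] by blast
  then have "range ((*) s) \<subseteq> J" using right_ideal_mult[OF sum_of_minimal_right_ideal] by blast
  then obtain e where e: "e * e = e" "range ((*) s) = range ((*) e)"
    using right_ideal_in_sum_of_minimal[OF sp J(1) right_ideal_range_mult] by blast
  have "e \<in> range ((*) s)" using e by (metis rangeI)
  then obtain z where "e = s * z" by auto
  moreover have "s \<in> range ((*) e)" using e(2) by (metis mult.right_neutral rangeI)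
  ultimately show ?thesis using idempotent_range_iff[OF e(1)] by metis
qed

text \<open>By induction the traces of the chain on \<open>J\<close> stabilize. If some term lies in
  \<open>J\<close>, later terms equal their traces. Otherwise each term together with
  \<open>J\<close> fills \<open>J + I\<close>, and equal traces force equal terms.\<close>

lemma sum_of_minimal_dcc:
  assumes "sum_of_minimal J" and "\<And>n. is_right_ideal (N n)" "\<And>n. N (Suc n) \<subseteq> N n" "\<And>n::nat. N n \<subseteq> J"
  shows "\<exists>d. \<forall>n\<ge>d. N n = N d"
  using assms
proof (induction J arbitrary: N rule: sum_of_minimal.induct)
  case zero
  then have "N n = {0}" for n using right_ideal_zero[of "N n"] by blast
  then show ?case by auto
next
  case (plus J I)
  note J = sum_of_minimal_right_ideal[OF plus.hyps(1)]
  have anti: "N m \<subseteq> N n" if "n \<le> m" for m n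
    using lift_Suc_antimono_le[of N, OF plus.prems(2) that] .
  obtain d where d: "\<And>n. n \<ge> d \<Longrightarrow> N n \<inter> J = N d \<inter> J"
    using plus.IH[of "\<lambda>n. N n \<inter> J"] plus.prems J by (auto intro: right_ideal_Int)
  show ?case
  proof (cases "\<exists>m. N m \<subseteq> J")
    case True
    then obtain m where m: "N m \<subseteq> J" by blast
    have "N n = N d \<inter> J" if "n \<ge> max d m" for n
      using d[of n] anti[of m n] m that by auto
    then show ?thesis by (intro exI[of _ "max d m"]) auto
  next
    case False
    have "N d \<subseteq> N n" if n: "n \<ge> d" for n
    proof
      fix a assume a: "a \<in> N d"
      have "a \<in> ideal_plus J (N n)"
        using right_ideal_in_plus_minimal[OF J plus.hyps(2) plus.prems(1,3), of n] False a plus.prems(3)[of d]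
        by blast
      then obtain j b where jb: "a = j + b" "j \<in> J" "b \<in> N n" by (auto simp: ideal_plus_def)
      then have "j = a - b" by simp
      then have "j \<in> N d" using right_ideal_diff[OF plus.prems(1) a] anti[OF n] jb(3) by blast
      then have "j \<in> N n" using d[OF n] jb(2) by blast
      then show "a \<in> N n" using right_ideal_add[OF plus.prems(1)] jb by blast
    qed
    then show ?thesis using anti by (intro exI[of _ d]) blast
  qed
qed

section \<open>B-Fredholm elements\<close>

text \<open>A representative \<open>b\<close> of the Drazin inverse is chosen, and the identities in
  the quotient become differences lying in the socle.\<close>

lemma B_Fredholm_imp:
  fixes t :: "'a::complex_banach_algebra_1"
  assumes "B_Fredholm t"
  obtains b k where "t ^ k * b * t - t ^ k \<in> socle algebra_ring" "t * b - b * t \<in> socle algebra_ring"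
proof -
  interpret ideal "socle algebra_ring" "algebra_ring :: 'a ring" by (rule ideal_socle)
  let ?Q = "algebra_ring Quot socle (algebra_ring :: 'a ring)"
  let ?p = "\<lambda>a::'a. socle algebra_ring +>\<^bsub>algebra_ring\<^esub> a"
  interpret hom: ring_hom_ring "algebra_ring :: 'a ring" ?Q ?p by (rule rcos_ring_hom_ring)
  have eq: "a - c \<in> socle algebra_ring" if "?p a = ?p c" for a c :: 'a
    using quotient_eq_iff_same_a_r_cos[of "socle algebra_ring" a c] that ideal_socle
    by (simp add: a_minus_def)
  obtain B k where B: "B \<in> carrier ?Q" "?p t \<otimes>\<^bsub>?Q\<^esub> B = B \<otimes>\<^bsub>?Q\<^esub> ?p t"
    "?p t [^]\<^bsub>?Q\<^esub> (k::nat) \<otimes>\<^bsub>?Q\<^esub> B \<otimes>\<^bsub>?Q\<^esub> ?p t = ?p t [^]\<^bsub>?Q\<^esub> k"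
    using assms unfolding B_Fredholm_def drazin_invertible_def by blast
  obtain b where b: "B = ?p b"
    using B(1) by (auto simp: FactRing_def A_RCOSETS_def')
  have hom: "?p (c * d) = ?p c \<otimes>\<^bsub>?Q\<^esub> ?p d" for c d
    using hom.hom_mult[of c d] by simp
  have "?p (t ^ k) = ?p t [^]\<^bsub>?Q\<^esub> k"
    using hom.hom_nat_pow[of t k] by simp
  then have "?p (t ^ k * b * t) = ?p (t ^ k)"
    using B(3) by (simp only: b hom)
  moreover have "?p (t * b) = ?p (b * t)"
    using B(2) by (simp only: b hom)
  ultimately show ?thesis using that eq by blast
qed

text \<open>Equality in the quotient by the socle, expressed on representatives so that chained
  calculations stay in the algebra.\<close>

definition cong_socle :: "'a::ring_1 \<Rightarrow> 'a \<Rightarrow> bool"  (infix \<open>=\<^sub>S\<close> 50)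
  where "a =\<^sub>S b \<longleftrightarrow> a - b \<in> socle algebra_ring"

lemma cong_socle_refl [simp]: "a =\<^sub>S a"
  by (simp add: cong_socle_def socle_zero)

lemma cong_socle_sym: "a =\<^sub>S b \<Longrightarrow> b =\<^sub>S a"
  unfolding cong_socle_def using socle_mult_right[of "a - b" "- 1"] by simp

lemma cong_socle_trans [trans]: "a =\<^sub>S b \<Longrightarrow> b =\<^sub>S c \<Longrightarrow> a =\<^sub>S c"
  unfolding cong_socle_def using socle_add[of "a - b" "b - c"] by simp

lemma cong_socle_mult: "a =\<^sub>S a' \<Longrightarrow> b =\<^sub>S b' \<Longrightarrow> a * b =\<^sub>S a' * b'"
  unfolding cong_socle_def
  using socle_add[OF socle_mult_right[of "a - a'" b] socle_mult_left[of "b - b'" a']]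
  by (simp add: left_diff_distrib right_diff_distrib)

lemma cong_socle_power_commute:
  assumes "x * y =\<^sub>S y * x"
  shows "x * y ^ n =\<^sub>S y ^ n * x"
proof (induction n)
  case (Suc n)
  have "x * y ^ Suc n = (x * y) * y ^ n" by (simp add: mult.assoc)
  also have "\<dots> =\<^sub>S (y * x) * y ^ n" by (intro cong_socle_mult assms cong_socle_refl)
  also have "(y * x) * y ^ n = y * (x * y ^ n)" by (simp add: mult.assoc)
  also have "\<dots> =\<^sub>S y * (y ^ n * x)" by (intro cong_socle_mult Suc cong_socle_refl)
  finally show ?case by (simp add: mult.assoc)
qed simp

text \<open>The defect \<open>s = a - a * c * a\<close> lies in the socle and is itself regular.
  Since \<open>a\<close> is both a left and a right factor of \<open>s\<close>, the term
  \<open>s * z * s\<close> can be absorbed into \<open>c\<close>.\<close>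

lemma regular_if_cong_regular:
  assumes sp: "semiprime (algebra_ring :: 'a::ring_1 ring)" and "a * c * a =\<^sub>S (a :: 'a)"
  shows "\<exists>c. a * c * a = a"
proof -
  define s where "s = a - a * c * a"
  have "s \<in> socle algebra_ring"
    using cong_socle_sym[OF assms(2)] by (simp add: s_def cong_socle_def)
  then obtain z where z: "s * z * s = s" using socle_regular[OF sp] by blast
  have "a * (1 - c * a) = s" "(1 - a * c) * a = s"
    by (simp_all add: s_def left_diff_distrib right_diff_distrib mult.assoc)
  then have "a * ((1 - c * a) * z * (1 - a * c)) * a = s"
    using z by (metis mult.assoc)
  then have "a * (c + (1 - c * a) * z * (1 - a * c)) * a = a * c * a + s"
    by (simp add: distrib_left distrib_right)
  also have "\<dots> = a" by (simp add: s_def)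
  finally show ?thesis by blast
qed

lemma range_power_antimono:
  fixes t :: "'a::monoid_mult"
  assumes "m \<le> n"
  shows "range ((*) (t ^ n)) \<subseteq> range ((*) (t ^ m))"
proof
  fix a assume "a \<in> range ((*) (t ^ n))"
  then obtain c where "a = t ^ n * c" by blast
  also have "t ^ n = t ^ m * t ^ (n - m)" using assms by (simp add: power_add[symmetric])
  finally have "a = t ^ m * (t ^ (n - m) * c)" by (simp add: mult.assoc)
  then show "a \<in> range ((*) (t ^ m))" by blast
qed

text \<open>With \<open>b\<close> representing the Drazin inverse,
  \<open>t ^ n * b ^ n * t ^ n\<close> is congruent to \<open>t ^ n\<close> for
  \<open>n \<ge> k\<close>, and regularity lifts. The kernel intersections from exponent
  \<open>k\<close> on all lie in the right ideal generated by one socle element, so the descending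
  chain condition applies.\<close>

lemma B_Fredholm_regular_stable:
  fixes t :: "'a::complex_banach_algebra_1"
  assumes sp: "semiprime (algebra_ring :: 'a ring)" and "B_Fredholm t"
  shows "\<exists>d. (\<forall>n\<ge>d. \<exists>c. t ^ n * c * t ^ n = t ^ n) \<and>
    (\<forall>n\<ge>d. right_annihilator t \<inter> range ((*) (t ^ n)) = right_annihilator t \<inter> range ((*) (t ^ d)))"
proof -
  obtain b k where "t ^ k * b * t - t ^ k \<in> socle algebra_ring"
    and "t * b - b * t \<in> socle algebra_ring"
    by (rule B_Fredholm_imp[OF assms(2)])
  then have tk: "t ^ k * (b * t) =\<^sub>S t ^ k" and tb: "t * b =\<^sub>S b * t"
    by (simp_all add: cong_socle_def mult.assoc)
  have bt: "(b * t) ^ j =\<^sub>S b ^ j * t ^ j" for j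
  proof (induction j)
    case (Suc j)
    have "(b * t) ^ Suc j =\<^sub>S (b * t) * (b ^ j * t ^ j)"
      unfolding power_Suc by (intro cong_socle_mult Suc cong_socle_refl)
    also have "(b * t) * (b ^ j * t ^ j) = b * ((t * b ^ j) * t ^ j)" by (simp add: mult.assoc)
    also have "\<dots> =\<^sub>S b * ((b ^ j * t) * t ^ j)"
      by (intro cong_socle_mult cong_socle_power_commute tb cong_socle_refl)
    finally show ?case by (simp add: mult.assoc)
  qed simp
  have tk': "t ^ k * (b * t) ^ j =\<^sub>S t ^ k" for j
  proof (induction j)
    case (Suc j)
    have "t ^ k * (b * t) ^ Suc j = t ^ k * (b * t) * (b * t) ^ j" by (simp add: mult.assoc)
    also have "\<dots> =\<^sub>S t ^ k * (b * t) ^ j" by (intro cong_socle_mult tk cong_socle_refl)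
    also note Suc
    finally show ?case .
  qed simp
  have reg: "\<exists>c. t ^ n * c * t ^ n = t ^ n" if n: "n \<ge> k" for n
  proof (rule regular_if_cong_regular[OF sp])
    \<comment> \<open>The factor \<open>t ^ k\<close> is split off because \<open>tk'\<close>
      absorbs powers of \<open>b * t\<close> standing next to it.\<close>
    have split: "t ^ n = t ^ (n - k) * t ^ k" using n by (simp add: power_add[symmetric])
    have "t ^ n * b ^ n * t ^ n = t ^ (n - k) * (t ^ k * (b ^ n * t ^ n))"
      by (subst (1) split) (simp only: mult.assoc)
    also have "\<dots> =\<^sub>S t ^ (n - k) * (t ^ k * (b * t) ^ n)"
      by (rule cong_socle_mult[OF cong_socle_refl cong_socle_mult[OF cong_socle_refl cong_socle_sym[OF bt]]])
    also have "\<dots> =\<^sub>S t ^ (n - k) * t ^ k" by (rule cong_socle_mult[OF cong_socle_refl tk'])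
    finally show "t ^ n * b ^ n * t ^ n =\<^sub>S t ^ n" by (simp only: split[symmetric])
  qed
  \<comment> \<open>If \<open>a = t ^ k * c\<close> and \<open>t * a = 0\<close>, then
    \<open>s * c = - a\<close>; hence every such \<open>a\<close> lies in \<open>s A\<close>, inside
    a finite sum of minimal right ideals containing \<open>s\<close>.\<close>
  define s where "s = b * t ^ Suc k - t ^ k"
  have "b * t ^ Suc k = b * t ^ k * t" by (simp only: mult.assoc power_Suc2)
  also have "\<dots> =\<^sub>S t ^ k * b * t"
    by (rule cong_socle_mult[OF cong_socle_power_commute[OF cong_socle_sym[OF tb]] cong_socle_refl])
  also have "\<dots> = t ^ k * (b * t)" by (simp add: mult.assoc)
  also note tk
  finally have "s \<in> socle algebra_ring" by (simp add: s_def cong_socle_def)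
  then obtain J where J: "sum_of_minimal J" "s \<in> J" using socle_in_sum_of_minimal by blast
  define N where "N n = right_annihilator t \<inter> range ((*) (t ^ (k + n)))" for n
  have "N n \<subseteq> J" for n
  proof
    fix a assume a: "a \<in> N n"
    then obtain c where "a = t ^ (k + n) * c" by (auto simp: N_def)
    then have ac: "a = t ^ k * (t ^ n * c)" by (simp add: power_add mult.assoc)
    moreover have "t ^ Suc k * (t ^ n * c) = t * a" by (simp add: ac mult.assoc)
    ultimately have "a = s * (- (t ^ n * c))"
      using a by (simp add: s_def N_def right_annihilator_def left_diff_distrib mult.assoc del: power_Suc)
    then show "a \<in> J" using right_ideal_mult[OF sum_of_minimal_right_ideal[OF J(1)] J(2)] by (simp del: mult_minus_right)
  qed
  moreover have "N (Suc n) \<subseteq> N n" for n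
    using range_power_antimono[of "k + n" "k + Suc n" t] by (auto simp: N_def simp del: add_Suc_right)
  moreover have "is_right_ideal (N n)" for n
    unfolding N_def right_annihilator_def
    by (intro right_ideal_Int right_ideal_right_annihilator right_ideal_range_mult)
  ultimately obtain d where d: "\<And>n. n \<ge> d \<Longrightarrow> N n = N d"
    using sum_of_minimal_dcc[OF J(1), of N] by blast
  show ?thesis
  proof (intro exI[of _ "k + d"] conjI allI impI)
    fix n assume n: "k + d \<le> n"
    then show "\<exists>c. t ^ n * c * t ^ n = t ^ n" by (intro reg) simp
    show "right_annihilator t \<inter> range ((*) (t ^ n)) = right_annihilator t \<inter> range ((*) (t ^ (k + d)))"
      using d[of "n - k"] n by (simp add: N_def)
  qed
qed

section \<open>Complex scalar multiplication\<close>

lemma bounded_linear_scaleC: "bounded_linear ((*\<^sub>C) c :: 'a::complex_banach_algebra_1 \<Rightarrow> 'a)"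
proof (rule bounded_linear_intro)
  show "norm (c *\<^sub>C x) \<le> norm x * cmod c" for x :: 'a by (simp add: norm_scaleC)
qed (simp_all add: scaleC_add_right scaleR_scaleC scaleC_scaleC mult.commute)

lemma scaleC_one [simp]: "1 *\<^sub>C (a::'a::complex_banach_algebra_1) = a"
  using scaleR_scaleC[of 1 a] by simp

lemma scaleC_zero_left [simp]: "0 *\<^sub>C (a::'a::complex_banach_algebra_1) = 0"
  using scaleR_scaleC[of 0 a] by simp

lemma scaleC_one_mult [simp]: "(c *\<^sub>C 1) * a = c *\<^sub>C (a::'a::complex_banach_algebra_1)"
  by (simp add: mult_scaleC_left)

lemma mult_scaleC_one [simp]: "a * (c *\<^sub>C 1) = c *\<^sub>C (a::'a::complex_banach_algebra_1)"
  by (simp add: mult_scaleC_right)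

lemma scaleC_zero_right [simp]: "c *\<^sub>C (0::'a::complex_banach_algebra_1) = 0"
  using mult_scaleC_left[of c 0 0] by simp

lemma scaleC_diff_right: "c *\<^sub>C (a - b) = c *\<^sub>C a - c *\<^sub>C (b::'a::complex_banach_algebra_1)"
  using scaleC_add_right[of c "a - b" b] by (simp add: algebra_simps)

lemma scaleC_diff_left: "(c - d) *\<^sub>C (a::'a::complex_banach_algebra_1) = c *\<^sub>C a - d *\<^sub>C a"
  using scaleC_add_left[of "c - d" d a] by (simp add: algebra_simps)

section \<open>Hahn--Banach and the identity theorem for Banach-valued functions\<close>

text \<open>Homogeneity is demanded only as an inequality for positive scalars, the form that passes
  easily to infima; equality follows by also scaling with the inverse.\<close>

definition sublinear :: "('a::real_vector \<Rightarrow> real) \<Rightarrow> bool"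
  where "sublinear q \<longleftrightarrow> (\<forall>x y. q (x + y) \<le> q x + q y) \<and> (\<forall>r>0. \<forall>x. q (r *\<^sub>R x) \<le> r * q x)"

lemma sublinear_add: "sublinear q \<Longrightarrow> q (x + y) \<le> q x + q y"
  by (simp add: sublinear_def)

lemma sublinear_scaleR:
  assumes "sublinear q" "r \<ge> 0"
  shows "q (r *\<^sub>R x) = r * q x"
proof -
  have le: "q (s *\<^sub>R y) \<le> s * q y" if "s > 0" for s y
    using assms that by (simp add: sublinear_def)
  have pos: "q (s *\<^sub>R y) = s * q y" if "s > 0" for s y
  proof (rule antisym)
    have "q y \<le> inverse s * q (s *\<^sub>R y)"
      using le[of "inverse s" "s *\<^sub>R y"] that by simp
    then show "s * q y \<le> q (s *\<^sub>R y)"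
      using that by (simp add: field_simps)
  qed (rule le[OF that])
  show ?thesis
    \<comment> \<open>For \<open>r = 0\<close>, scaling the zero vector by 2 gives
      \<open>q 0 = 2 * q 0\<close>.\<close>
    using pos[of 2 0] pos[of r x] assms(2) by (cases "r = 0") auto
qed

lemma sublinear_zero: "sublinear q \<Longrightarrow> q 0 = 0"
  using sublinear_scaleR[of q 0 0] by simp

lemma sublinear_ge: "sublinear q \<Longrightarrow> - q (- x) \<le> q x"
  using sublinear_add[of q x "- x"] sublinear_zero[of q] by simp

lemma sublinear_norm: "sublinear norm"
  by (simp add: sublinear_def norm_triangle_ineq)

text \<open>Taking an infimum along the ray in direction \<open>y\<close> lowers \<open>q\<close> so
  far that its value at \<open>- y\<close> drops to \<open>- q y\<close> or below. A minimal
  sublinear functional cannot be lowered, which is how linearity will be obtained.\<close>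

lemma sublinear_shift:
  fixes q :: "'a::real_vector \<Rightarrow> real"
  assumes q: "sublinear q"
  shows "\<exists>q'. sublinear q' \<and> q' \<le> q \<and> q' (- y) \<le> - q y"
proof -
  define q' where "q' x = (INF s\<in>{0..}. q (x + s *\<^sub>R y) - s * q y)" for x
  have bdd: "bdd_below ((\<lambda>s. q (x + s *\<^sub>R y) - s * q y) ` {0..})" for x
  proof (rule bdd_belowI2)
    fix s :: real assume "s \<in> {0..}"
    then have "s * q y = q (s *\<^sub>R y)"
      using q by (simp add: sublinear_scaleR)
    also have "\<dots> \<le> q (x + s *\<^sub>R y) + q (- x)"
      using sublinear_add[OF q, of "x + s *\<^sub>R y" "- x"] by simp
    finally show "- q (- x) \<le> q (x + s *\<^sub>R y) - s * q y" by simp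
  qed
  have lower: "q' x \<le> q (x + s *\<^sub>R y) - s * q y" if "s \<ge> 0" for x s
    unfolding q'_def by (rule cINF_lower[OF bdd]) (use that in simp)
  have greatest: "m \<le> q' x" if "\<And>s. s \<ge> 0 \<Longrightarrow> m \<le> q (x + s *\<^sub>R y) - s * q y" for m x
    unfolding q'_def by (rule cINF_greatest) (use that in auto)
  have "q' (x + z) \<le> q' x + q' z" for x z
  proof -
    have "q' (x + z) - (q (x + s *\<^sub>R y) - s * q y) \<le> q' z" if s: "s \<ge> 0" for s
    proof (rule greatest)
      fix r :: real assume r: "r \<ge> 0"
      have "q' (x + z) \<le> q ((x + z) + (s + r) *\<^sub>R y) - (s + r) * q y"
        using r s by (intro lower) simp
      moreover have "(x + z) + (s + r) *\<^sub>R y = (x + s *\<^sub>R y) + (z + r *\<^sub>R y)"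
        by (simp add: algebra_simps)
      ultimately show "q' (x + z) - (q (x + s *\<^sub>R y) - s * q y) \<le> q (z + r *\<^sub>R y) - r * q y"
        using sublinear_add[OF q, of "x + s *\<^sub>R y" "z + r *\<^sub>R y"] by (simp add: algebra_simps)
    qed
    then have "q' (x + z) - q' z \<le> q' x"
      by (intro greatest) (simp add: algebra_simps)
    then show ?thesis by simp
  qed
  moreover have "q' (r *\<^sub>R x) \<le> r * q' x" if r: "r > 0" for r x
  proof -
    have "q' (r *\<^sub>R x) / r \<le> q' x"
    proof (rule greatest)
      fix s :: real assume s: "s \<ge> 0"
      have "q' (r *\<^sub>R x) \<le> q (r *\<^sub>R x + (r * s) *\<^sub>R y) - (r * s) * q y"
        using r s by (intro lower) simp
      also have "r *\<^sub>R x + (r * s) *\<^sub>R y = r *\<^sub>R (x + s *\<^sub>R y)"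
        by (simp add: algebra_simps)
      also have "q \<dots> = r * q (x + s *\<^sub>R y)"
        using q r by (simp add: sublinear_scaleR)
      finally show "q' (r *\<^sub>R x) / r \<le> q (x + s *\<^sub>R y) - s * q y"
        using r by (simp add: field_simps)
    qed
    then show ?thesis using r by (simp add: field_simps)
  qed
  ultimately have "sublinear q'" by (simp add: sublinear_def)
  moreover have "q' \<le> q"
    using lower[of 0] by (simp add: le_fun_def)
  moreover have "q' (- y) \<le> - q y"
    \<comment> \<open>The parameter \<open>s = 1\<close> at the point \<open>- y\<close> leaves
      \<open>q 0 - q y\<close>.\<close>
    using lower[of 1 "- y"] sublinear_zero[OF q] by simp
  ultimately show ?thesis by blast
qed

text \<open>Supplies the bounds for Zorn's lemma. The common upper bound \<open>p\<close> keeps the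
  pointwise infimum finite, since \<open>- p (- x)\<close> lies below every \<open>q x\<close>;
  subadditivity survives because the smaller of two members of the chain is below both.\<close>

lemma sublinear_Inf_chain:
  fixes C :: "('a::real_vector \<Rightarrow> real) set"
  assumes "C \<noteq> {}" and sub: "\<And>q. q \<in> C \<Longrightarrow> sublinear q"
    and bdd: "\<And>q. q \<in> C \<Longrightarrow> q \<le> p"
    and chain: "\<And>q r. q \<in> C \<Longrightarrow> r \<in> C \<Longrightarrow> q \<le> r \<or> r \<le> q"
  shows "\<exists>u. sublinear u \<and> (\<forall>q\<in>C. u \<le> q)"
proof -
  define u where "u x = (INF q\<in>C. q x)" for x
  have "bdd_below ((\<lambda>q. q x) ` C)" for x
  proof (rule bdd_belowI2)
    fix q assume "q \<in> C"
    then show "- p (- x) \<le> q x"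
      using sublinear_ge[OF sub, of q x] bdd[of q] by (simp add: le_fun_def) (smt (verit))
  qed
  then have lower: "u x \<le> q x" if "q \<in> C" for q x
    unfolding u_def using that by (rule cINF_lower)
  have greatest: "m \<le> u x" if "\<And>q. q \<in> C \<Longrightarrow> m \<le> q x" for m x
    unfolding u_def using that \<open>C \<noteq> {}\<close> by (intro cINF_greatest) auto
  have "u (x + y) \<le> u x + u y" for x y
  proof -
    have "u (x + y) - q x \<le> u y" if q: "q \<in> C" for q
    proof (rule greatest)
      fix r assume r: "r \<in> C"
      obtain s where "s \<in> C" "s \<le> q" "s \<le> r" using chain[OF q r] q r by blast
      then show "u (x + y) - q x \<le> r y"
        using lower[of s "x + y"] sublinear_add[OF sub, of s x y] by (simp add: le_fun_def) (smt (verit))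
    qed
    then have "u (x + y) - u y \<le> u x"
      by (intro greatest) (simp add: algebra_simps)
    then show ?thesis by simp
  qed
  moreover have "u (r *\<^sub>R x) \<le> r * u x" if r: "r > 0" for r x
  proof -
    have "u (r *\<^sub>R x) / r \<le> u x"
    proof (rule greatest)
      fix q assume "q \<in> C"
      then show "u (r *\<^sub>R x) / r \<le> q x"
        using lower[of q "r *\<^sub>R x"] sublinear_scaleR[OF sub, of q r x] r by (simp add: field_simps)
    qed
    then show ?thesis using r by (simp add: field_simps)
  qed
  ultimately have "sublinear u" by (simp add: sublinear_def)
  then show ?thesis using lower by (auto simp: le_fun_def)
qed

text \<open>By minimality the shifted functional is \<open>q\<close> itself, so \<open>q\<close> is
  odd, and an odd sublinear functional is linear.\<close>

lemma sublinear_minimal_linear: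
  fixes q :: "'a::real_vector \<Rightarrow> real"
  assumes q: "sublinear q" and min: "\<And>r. sublinear r \<Longrightarrow> r \<le> q \<Longrightarrow> r = q"
  shows "linear q"
proof -
  have neg: "q (- y) = - q y" for y
    using sublinear_shift[OF q, of y] min sublinear_ge[OF q, of y] by (metis add.inverse_inverse antisym le_minus_iff)
  show ?thesis
  proof
    show "q (x + y) = q x + q y" for x y
      using sublinear_add[OF q, of x y] sublinear_add[OF q, of "- x" "- y"] neg[of "x + y"] neg[of x] neg[of y]
      by simp
    show "q (r *\<^sub>R x) = r *\<^sub>R q x" for r x
      using sublinear_scaleR[OF q, of r x] sublinear_scaleR[OF q, of "- r" x] neg[of "r *\<^sub>R x"]
      by (cases "r \<ge> 0") auto
  qed
qed

text \<open>Hahn--Banach: a minimal sublinear functional below the norm is linear.\<close>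

lemma exists_norming_functional:
  fixes a :: "'a::real_normed_vector"
  shows "\<exists>\<phi>::'a \<Rightarrow> real. bounded_linear \<phi> \<and> \<phi> a = norm a"
proof -
  \<comment> \<open>Searching below this \<open>p\<close> instead of below the norm controls the
    value at \<open>a\<close>: every linear functional below \<open>p\<close> is at least
    \<open>norm a\<close> there.\<close>
  obtain p :: "'a \<Rightarrow> real" where p: "sublinear p" "p \<le> norm" "p (- a) \<le> - norm a"
    using sublinear_shift[OF sublinear_norm] by blast
  define A where "A = {q. sublinear q \<and> q \<le> p}"
  have "\<exists>\<phi>\<in>A. \<forall>q\<in>A. q \<le> \<phi> \<longrightarrow> q = \<phi>"
  proof (rule predicate_Zorn)
    \<comment> \<open>The order is reversed, so a maximal element for Zorn's lemma is a minimal
      sublinear functional.\<close>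
    show "partial_order_on A (relation_of (\<lambda>q r. r \<le> q) A)"
      by (rule partial_order_on_relation_ofI) auto
  next
    fix C assume C: "C \<in> Chains (relation_of (\<lambda>q r. r \<le> q) A)"
    show "\<exists>u\<in>A. \<forall>q\<in>C. u \<le> q"
    proof (cases "C = {}")
      case True
      then show ?thesis using p by (auto simp: A_def)
    next
      case False
      have CA: "C \<subseteq> A" and ch: "\<And>q r. q \<in> C \<Longrightarrow> r \<in> C \<Longrightarrow> q \<le> r \<or> r \<le> q"
        using C by (auto simp: Chains_def relation_of_def)
      obtain u where u: "sublinear u" "\<forall>q\<in>C. u \<le> q"
        using sublinear_Inf_chain[of C p] False CA ch unfolding A_def by blast
      moreover have "u \<le> p" using u(2) CA False unfolding A_def by (blast intro: order_trans)
      ultimately show ?thesis unfolding A_def by blast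
    qed
  qed
  then obtain \<phi> where \<phi>: "sublinear \<phi>" "\<phi> \<le> p" "\<And>q. sublinear q \<Longrightarrow> q \<le> \<phi> \<Longrightarrow> q = \<phi>"
    unfolding A_def by (blast intro: order_trans)
  have lin: "linear \<phi>" using \<phi>(1,3) by (rule sublinear_minimal_linear)
  have le: "\<phi> x \<le> norm x" for x using \<phi>(2) p(2) by (meson le_fun_def order_trans)
  have abs: "norm (\<phi> x) \<le> norm x * 1" for x
    using le[of x] le[of "- x"] linear_neg[OF lin, of x] by simp
  have "- \<phi> a \<le> - norm a"
    using \<phi>(2) p(3) linear_neg[OF lin, of a] by (metis le_fun_def order_trans)
  then have "\<phi> a = norm a" using le[of a] by simp
  moreover have "bounded_linear \<phi>"
    using lin abs unfolding bounded_linear_def bounded_linear_axioms_def by blast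
  ultimately show ?thesis by blast
qed

text \<open>A functional attaining the norm of \<open>f z\<close> is composed with \<open>f\<close>;
  the scalar identity theorem makes the composite vanish at \<open>z\<close>, hence also the norm of
  \<open>f z\<close>.\<close>

lemma banach_identity_theorem:
  fixes f :: "complex \<Rightarrow> 'a::complex_banach_algebra_1"
  assumes U: "open U" "connected U" and hol: "banach_holomorphic_on f U"
    and V: "open V" "V \<subseteq> U" "V \<noteq> {}" "\<And>z. z \<in> V \<Longrightarrow> f z = 0" and z: "z \<in> U"
  shows "f z = 0"
proof -
  obtain \<phi> :: "'a \<Rightarrow> real" where \<phi>: "bounded_linear \<phi>" "\<phi> (f z) = norm (f z)"
    using exists_norming_functional by blast
  interpret \<phi>: bounded_linear \<phi> by fact
  \<comment> \<open>The usual complexification: the complex linear functional with real part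
    \<open>\<phi>\<close>.\<close>
  define \<psi> where "\<psi> a = Complex (\<phi> a) (- \<phi> (\<i> *\<^sub>C a))" for a
  have \<psi>: "bounded_linear \<psi>"
    unfolding \<psi>_def Complex_eq
    by (intro bounded_linear_intros bounded_linear_compose[OF \<phi>(1)] bounded_linear_add
        bounded_linear_compose[OF bounded_linear_of_real] bounded_linear_minus
        bounded_linear_compose[OF bounded_linear_mult_right] bounded_linear_scaleC bounded_linear_ident)
  have \<psi>_scaleC: "\<psi> (h *\<^sub>C D) = h * \<psi> D" for h D
  proof -
    have "h *\<^sub>C D = Re h *\<^sub>R D + Im h *\<^sub>R (\<i> *\<^sub>C D)"
      by (simp add: scaleR_scaleC scaleC_scaleC scaleC_add_left[symmetric] mult.commute flip: complex_eq)
    moreover have "\<i> *\<^sub>C h *\<^sub>C D = Re h *\<^sub>R (\<i> *\<^sub>C D) - Im h *\<^sub>R D"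
    proof -
      have "\<i> *\<^sub>C h *\<^sub>C D = (\<i> * (Re h + \<i> * Im h)) *\<^sub>C D"
        by (simp add: scaleC_scaleC flip: complex_eq)
      also have "\<i> * (Re h + \<i> * Im h) = Re h * \<i> + complex_of_real (- Im h)"
        by (simp add: algebra_simps)
      finally show ?thesis
        by (simp add: scaleC_add_left scaleC_scaleC[symmetric] scaleR_scaleC[symmetric] del: of_real_minus)
    qed
    ultimately show ?thesis
      by (simp add: \<psi>_def complex_eq_iff \<phi>.add \<phi>.diff \<phi>.scale)
  qed
  have "(\<lambda>w. \<psi> (f w)) holomorphic_on U"
    unfolding holomorphic_on_def field_differentiable_def
  proof
    fix w assume "w \<in> U"
    then obtain D where "(f has_derivative (\<lambda>h. h *\<^sub>C D)) (at w within U)"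
      using hol by (auto simp: banach_holomorphic_on_def)
    then have "((\<lambda>w. \<psi> (f w)) has_derivative (\<lambda>h. \<psi> (h *\<^sub>C D))) (at w within U)"
      by (rule bounded_linear.has_derivative[OF \<psi>])
    then show "\<exists>D. ((\<lambda>w. \<psi> (f w)) has_field_derivative D) (at w within U)"
      by (auto simp: \<psi>_scaleC has_field_derivative_def mult.commute[of _ "\<psi> D"] intro!: exI[of _ "\<psi> D"])
  qed
  moreover have "\<psi> (f w) = 0" if "w \<in> V" for w
    using V(4)[OF that] \<psi> by (simp add: linear_0 bounded_linear.linear)
  ultimately have "\<psi> (f z) = 0"
    using analytic_continuation_open[of V U "\<lambda>w. \<psi> (f w)" "\<lambda>_. 0"] V U z by auto
  then show ?thesis using \<phi>(2) by (simp add: \<psi>_def complex_eq_iff)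
qed

section \<open>Neumann series\<close>

definition neumann :: "'a::{real_normed_algebra_1,banach} \<Rightarrow> 'a"
  where "neumann a = (\<Sum>n. a ^ n)"

context
  fixes a :: "'a::{real_normed_algebra_1,banach}"
  assumes a: "norm a < 1"
begin

lemma neumann_sums: "(\<lambda>n. a ^ n) sums neumann a"
  unfolding neumann_def using complete_algebra_summable_geometric[OF a] by (rule summable_sums)

lemma neumann_telescope: "(\<lambda>n. a ^ n - a ^ Suc n) sums 1"
  using telescope_sums'[OF summable_LIMSEQ_zero[OF complete_algebra_summable_geometric[OF a]]] by simp

lemma neumann_right: "(1 - a) * neumann a = 1"
  using sums_mult[OF neumann_sums, of "1 - a"] neumann_telescope
  by (simp add: left_diff_distrib sums_unique2)

lemma neumann_left: "neumann a * (1 - a) = 1"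
  using sums_mult2[OF neumann_sums, of "1 - a"] neumann_telescope
  by (simp add: right_diff_distrib power_commutes sums_unique2)

lemma neumann_unfold_right: "neumann a = 1 + a * neumann a"
  using neumann_right by (simp add: left_diff_distrib algebra_simps)

lemma norm_neumann_le: "norm (neumann a) \<le> 1 / (1 - norm a)"
proof -
  have "norm (neumann a) \<le> 1 + norm a * norm (neumann a)"
    using norm_triangle_ineq[of 1 "a * neumann a"] norm_mult_ineq[of a "neumann a"]
    by (subst neumann_unfold_right) simp
  then show ?thesis using a by (simp add: field_simps)
qed

end

section \<open>Ascent and descent\<close>

lemma Inf_enat_Collect:
  shows "Inf {enat n | n. P n} < \<infinity> \<longleftrightarrow> (\<exists>n. P n)"
    and "\<exists>n. P n \<Longrightarrow> \<exists>n. Inf {enat n | n. P n} = enat n \<and> P n"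
proof -
  show ex: "\<exists>n. Inf {enat n | n. P n} = enat n \<and> P n" if "\<exists>n. P n"
  proof (intro exI conjI)
    show "P (LEAST n. P n)" using that by (rule LeastI_ex)
    then show "Inf {enat n | n. P n} = enat (LEAST n. P n)"
      by (intro antisym Inf_lower Inf_greatest) (auto intro: Least_le)
  qed
  show "Inf {enat n | n. P n} < \<infinity> \<longleftrightarrow> (\<exists>n. P n)"
  proof
    assume "Inf {enat n | n. P n} < \<infinity>"
    then show "\<exists>n. P n" by (rule contrapos_pp) (simp add: top_enat_def)
  qed (use ex in fastforce)
qed

lemma funpow_mult_left: "((\<lambda>a. x * a) ^^ n) a = x ^ n * (a::'a::monoid_mult)"
  by (induction n) (simp_all add: mult.assoc)

lemma funpow_mult_right: "((\<lambda>a. a * x) ^^ n) a = a * (x::'a::monoid_mult) ^ n"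
  by (induction n) (simp_all add: mult.assoc power_commutes)

lemma left_ascent_eq:
  "left_ascent t = Inf {enat n | n. right_annihilator (t ^ n) = right_annihilator (t ^ Suc n)}"
  by (simp add: left_ascent_def ascent_def funpow_mult_left right_annihilator_def del: funpow.simps)

text \<open>The ranges are the left ideals generated by consecutive powers of \<open>t\<close>; they
  agree as soon as the generator \<open>t ^ n\<close> of the larger lies in the smaller.\<close>

lemma right_descent_eq: "right_descent t = Inf {enat n | n. \<exists>y. y * t ^ Suc n = t ^ n}"
proof -
  have "range (\<lambda>a. a * t ^ n) = range (\<lambda>a. a * t ^ Suc n) \<longleftrightarrow> (\<exists>y. y * t ^ Suc n = t ^ n)" (is "?L = ?R \<longleftrightarrow> _") for n
  proof
    assume "?L = ?R"
    moreover have "t ^ n \<in> ?L" by (metis mult_1 rangeI)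
    ultimately show "\<exists>y. y * t ^ Suc n = t ^ n" by (metis imageE)
  next
    assume "\<exists>y. y * t ^ Suc n = t ^ n"
    then obtain y where y: "y * t ^ Suc n = t ^ n" ..
    show "?L = ?R"
    proof (rule equalityI; rule subsetI)
      fix b assume "b \<in> ?L"
      then obtain a where "b = a * t ^ n" by blast
      then have "b = (a * y) * t ^ Suc n" using y by (simp add: mult.assoc del: power_Suc)
      then show "b \<in> ?R" by blast
    next
      fix b assume "b \<in> ?R"
      then obtain a where "b = a * t ^ Suc n" by blast
      then have "b = (a * t) * t ^ n" by (simp add: mult.assoc)
      then show "b \<in> ?L" by blast
    qed
  qed
  then show ?thesis
    by (simp add: right_descent_def descent_def funpow_mult_right del: funpow.simps power_Suc)
qed

lemma right_annihilator_power_mono: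
  "m \<le> n \<Longrightarrow> right_annihilator (t ^ m) \<subseteq> right_annihilator (t ^ n)"
proof
  fix a assume "m \<le> n" "a \<in> right_annihilator (t ^ m)"
  moreover from \<open>m \<le> n\<close> have "t ^ n = t ^ (n - m) * t ^ m" by (simp add: power_add[symmetric])
  ultimately show "a \<in> right_annihilator (t ^ n)" by (simp add: right_annihilator_def mult.assoc)
qed

lemma right_annihilator_power_stable:
  assumes "right_annihilator (t ^ p) = right_annihilator (t ^ Suc p)" "p \<le> n"
  shows "right_annihilator (t ^ n) = right_annihilator (t ^ p)"
  using assms(2)
proof (induction n rule: dec_induct)
  case (step n)
  have "a \<in> right_annihilator (t ^ p)" if "a \<in> right_annihilator (t ^ Suc n)" for a
  proof -
    have "t ^ n * (t * a) = 0" using that by (simp add: right_annihilator_def power_commutes flip: mult.assoc)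
    then have "t * a \<in> right_annihilator (t ^ p)" by (simp add: step.IH[symmetric]) (simp add: right_annihilator_def)
    then have "a \<in> right_annihilator (t ^ Suc p)"
      by (simp add: right_annihilator_def power_commutes flip: mult.assoc)
    then show ?thesis using assms(1) by simp
  qed
  moreover have "right_annihilator (t ^ p) \<subseteq> right_annihilator (t ^ Suc n)"
    using step.hyps by (intro right_annihilator_power_mono) simp
  ultimately show ?case by blast
qed simp

lemma Union_right_annihilator_power:
  assumes "right_annihilator (t ^ p) = right_annihilator (t ^ Suc p)"
  shows "(\<Union>n\<in>{1::nat..}. right_annihilator (t ^ n)) = right_annihilator (t ^ p)"
proof -
  have "right_annihilator (t ^ n) \<subseteq> right_annihilator (t ^ p)" for n
    using right_annihilator_power_stable[OF assms, of n] right_annihilator_power_mono[of n p t]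
    by (cases "p \<le> n") auto
  then show ?thesis
    using assms by (auto intro!: bexI[of _ "Suc p"])
qed

text \<open>Left multiplication by \<open>y\<close> turns \<open>t ^ Suc n * a = 0\<close> into
  \<open>t ^ n * a = 0\<close>. Hence finite right descent entails finite left ascent.\<close>

lemma right_annihilator_power_eq_if_left_regular:
  assumes "y * t ^ Suc n = t ^ n"
  shows "right_annihilator (t ^ n) = right_annihilator (t ^ Suc n)"
proof
  show "right_annihilator (t ^ Suc n) \<subseteq> right_annihilator (t ^ n)"
  proof
    fix a assume "a \<in> right_annihilator (t ^ Suc n)"
    then have "y * t ^ Suc n * a = 0" by (simp add: right_annihilator_def mult.assoc del: power_Suc)
    then show "a \<in> right_annihilator (t ^ n)" by (simp add: right_annihilator_def assms del: power_Suc)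
  qed
qed (rule right_annihilator_power_mono, simp)

lemma left_regular_power:
  fixes t :: "'a::monoid_mult"
  assumes y: "y * t ^ Suc n = t ^ n"
  shows "y ^ m * t ^ (n + m) = t ^ n"
proof (induction m)
  case (Suc m)
  have "y ^ Suc m * t ^ (n + Suc m) = y ^ m * y * (t ^ Suc n * t ^ m)"
    by (simp only: power_Suc2[of y] power_add[symmetric] add_Suc add_Suc_right)
  also have "\<dots> = y ^ m * (y * t ^ Suc n) * t ^ m" by (simp only: mult.assoc)
  also have "\<dots> = t ^ n" using Suc by (simp only: y mult.assoc power_add)
  finally show ?case .
qed simp

section \<open>The quasinilpotent part under finite ascent\<close>

lemma right_annihilator_subset_quasinilpotent:
  "right_annihilator (t ^ p) \<subseteq> left_quasinilpotent_part t"
proof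
  fix a assume a: "a \<in> right_annihilator (t ^ p)"
  have "\<forall>\<^sub>F n in sequentially. root n (norm (t ^ n * a)) = 0"
    using eventually_ge_at_top[of p]
  proof eventually_elim
    case (elim n)
    then have "t ^ n * a = 0"
      using a right_annihilator_power_mono[OF elim, of t] by (auto simp: right_annihilator_def)
    then show ?case by simp
  qed
  then show "a \<in> left_quasinilpotent_part t"
    unfolding left_quasinilpotent_part_def by (simp add: tendsto_eventually)
qed

text \<open>In \<open>t ^ n * a = y ^ m * (t ^ (n + m) * a)\<close> the first factor grows at most
  geometrically in \<open>m\<close>, while the second decays faster than any geometric
  sequence.\<close>

lemma quasinilpotent_subset_right_annihilator:
  assumes y: "y * t ^ Suc n = t ^ n"
  shows "left_quasinilpotent_part t \<subseteq> right_annihilator (t ^ n)"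
proof
  fix a assume "a \<in> left_quasinilpotent_part t"
  then have lim: "(\<lambda>m. root m (norm (t ^ m * a))) \<longlonglongrightarrow> 0"
    by (simp add: left_quasinilpotent_part_def)
  \<comment> \<open>The summand 1 covers \<open>y = 0\<close>, and \<open>e \<le> 1 / 2\<close>
    allows \<open>e ^ (n + m)\<close> to be replaced by \<open>e ^ m\<close>.\<close>
  define e where "e = 1 / (2 * (norm y + 1))"
  have e: "0 < e" "e \<le> 1 / 2" "norm y * e \<le> 1 / 2"
    by (simp_all add: e_def field_simps add_pos_nonneg)
  have "\<forall>\<^sub>F m in sequentially. root m (norm (t ^ m * a)) < e"
    using order_tendstoD(2)[OF lim e(1)] .
  then obtain k where k: "\<And>m. m \<ge> k \<Longrightarrow> root m (norm (t ^ m * a)) < e"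
    by (auto simp: eventually_sequentially)
  have "\<forall>\<^sub>F m in sequentially. norm (t ^ n * a) \<le> (1 / 2) ^ m"
    \<comment> \<open>The successor makes \<open>n + m\<close> positive, so that the power undoes
      the root.\<close>
    using eventually_ge_at_top[of "Suc k"]
  proof eventually_elim
    case (elim m)
    have "norm (t ^ (n + m) * a) = root (n + m) (norm (t ^ (n + m) * a)) ^ (n + m)"
      using elim by simp
    also have "\<dots> \<le> e ^ (n + m)"
      using k[of "n + m"] elim by (intro power_mono) (auto simp: real_root_ge_zero)
    also have "\<dots> \<le> e ^ m"
      using e by (intro power_decreasing) auto
    finally have small: "norm (t ^ (n + m) * a) \<le> e ^ m" .
    have "norm (t ^ n * a) = norm (y ^ m * (t ^ (n + m) * a))"
      by (simp only: mult.assoc[symmetric] left_regular_power[OF y])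
    also have "\<dots> \<le> norm y ^ m * e ^ m"
      by (intro order_trans[OF norm_mult_ineq] mult_mono norm_power_ineq small) simp_all
    also have "\<dots> = (norm y * e) ^ m" by (simp add: power_mult_distrib)
    also have "\<dots> \<le> (1 / 2) ^ m" using e by (intro power_mono) auto
    finally show ?case .
  qed
  moreover have "(\<lambda>m. (1 / 2 :: real) ^ m) \<longlonglongrightarrow> 0" by (rule LIMSEQ_realpow_zero) auto
  ultimately have "norm (t ^ n * a) \<le> 0"
    by (intro tendsto_lowerbound[of _ 0 sequentially]) auto
  then show "a \<in> right_annihilator (t ^ n)" by (simp add: right_annihilator_def)
qed

text \<open>The exponent \<open>n\<close> comes from left regularity and \<open>p\<close> from the
  ascent; stability of the kernels from \<open>p\<close> on reconciles them.\<close>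

lemma quasinilpotent_part_eq:
  assumes y: "y * t ^ Suc n = t ^ n"
    and p: "right_annihilator (t ^ p) = right_annihilator (t ^ Suc p)"
  shows "left_quasinilpotent_part t = right_annihilator (t ^ p)"
proof
  have "right_annihilator (t ^ n) \<subseteq> right_annihilator (t ^ p)"
    using right_annihilator_power_stable[OF p, of n] right_annihilator_power_mono[of n p t]
    by (cases "p \<le> n") auto
  then show "left_quasinilpotent_part t \<subseteq> right_annihilator (t ^ p)"
    using quasinilpotent_subset_right_annihilator[OF y] by blast
qed (rule right_annihilator_subset_quasinilpotent)

section \<open>Elements with regular powers and stable kernel intersections\<close>

text \<open>The idempotent \<open>p\<close> satisfies \<open>t ^ n * p = t ^ n\<close>, and
  \<open>w\<close> is a left inverse of \<open>t\<close> up to \<open>p\<close>. For small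
  \<open>\<mu>\<close> a Neumann series puts \<open>p\<close> into the left ideal generated by
  \<open>t - \<mu>\<close>. So this ideal contains \<open>t ^ n\<close>; it also contains
  \<open>t ^ n - \<mu> ^ n\<close>, hence the nonzero scalar \<open>\<mu> ^ n\<close>.\<close>

lemma left_invertible_near:
  fixes t :: "'a::complex_banach_algebra_1"
  assumes y: "y * t ^ Suc n = t ^ n" and c: "t ^ n * c * t ^ n = t ^ n"
  shows "\<exists>\<epsilon>>0. \<forall>\<mu>. \<mu> \<noteq> 0 \<longrightarrow> cmod \<mu> < \<epsilon> \<longrightarrow> (\<exists>z. z * (t - \<mu> *\<^sub>C 1) = 1)"
proof -
  define p where "p = c * t ^ n"
  define w where "w = c * y * t ^ n"
  have tp: "t ^ n * p = t ^ n" using c by (simp add: p_def mult.assoc)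
  have wp: "w * p = w" using c by (simp add: p_def w_def mult.assoc)
  have wt: "w * t = p"
    using y by (simp add: p_def w_def mult.assoc power_commutes)
  show ?thesis
  proof (intro exI[of _ "1 / (norm w + 1)"] conjI allI impI)
    show "0 < 1 / (norm w + 1)" by (simp add: add_nonneg_pos)
    fix \<mu> assume \<mu>: "\<mu> \<noteq> 0" "cmod \<mu> < 1 / (norm w + 1)"
    have "norm (\<mu> *\<^sub>C w) < 1"
    proof -
      have "cmod \<mu> * (norm w + 1) < 1"
        using \<mu>(2) by (simp add: pos_less_divide_eq add_nonneg_pos)
      then have "cmod \<mu> * norm w + cmod \<mu> < 1" by (simp add: distrib_left)
      then show ?thesis using norm_ge_zero[of \<mu>] unfolding norm_scaleC by linarith
    qed
    note inv = neumann_left[OF this]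
    let ?m = "\<mu> *\<^sub>C (1::'a)" and ?g = "neumann (\<mu> *\<^sub>C w)"
    \<comment> \<open>Because \<open>w = w * p\<close>, the idempotent \<open>p\<close> factors out
      on the right.\<close>
    have "w * (t - ?m) = (1 - \<mu> *\<^sub>C w) * p"
      by (simp add: right_diff_distrib left_diff_distrib wt mult_scaleC_left wp)
    then have gw: "?g * w * (t - ?m) = p"
      by (metis inv mult.assoc mult_1)
    have "\<exists>v. t ^ k - (\<mu> ^ k) *\<^sub>C 1 = v * (t - ?m)" for k
    proof (induction k)
      case (Suc k)
      then obtain v where v: "t ^ k - (\<mu> ^ k) *\<^sub>C 1 = v * (t - ?m)" ..
      have "t ^ Suc k - (\<mu> ^ Suc k) *\<^sub>C 1 = t * (t ^ k - (\<mu> ^ k) *\<^sub>C 1) + (\<mu> ^ k) *\<^sub>C 1 * (t - ?m)"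
        by (simp add: right_diff_distrib scaleC_scaleC mult.commute)
      also have "\<dots> = (t * v + (\<mu> ^ k) *\<^sub>C 1) * (t - ?m)"
        by (simp add: v distrib_right mult.assoc)
      finally show ?case ..
    qed (auto intro: exI[of _ 0])
    then obtain v where v: "t ^ n - (\<mu> ^ n) *\<^sub>C 1 = v * (t - ?m)" ..
    have "(t ^ n * ?g * w - v) * (t - ?m) = t ^ n * (?g * w * (t - ?m)) - v * (t - ?m)"
      by (simp only: left_diff_distrib mult.assoc)
    also have "\<dots> = (\<mu> ^ n) *\<^sub>C 1"
      by (simp add: gw tp v[symmetric])
    finally have "(inverse (\<mu> ^ n)) *\<^sub>C ((t ^ n * ?g * w - v) * (t - ?m)) = 1"
      using \<mu>(1) by (simp add: scaleC_scaleC)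
    then have "((inverse (\<mu> ^ n)) *\<^sub>C (t ^ n * ?g * w - v)) * (t - ?m) = 1"
      by (simp only: mult_scaleC_left)
    then show "\<exists>z. z * (t - ?m) = 1" ..
  qed
qed

text \<open>Records the two algebraic consequences of B-Fredholmness from which the analytic part
  proceeds.\<close>

locale stably_regular =
  fixes t :: "'a::complex_banach_algebra_1" and d :: nat
  assumes regular: "n \<ge> d \<Longrightarrow> \<exists>c. t ^ n * c * t ^ n = t ^ n"
    and stable: "n \<ge> d \<Longrightarrow> right_annihilator t \<inter> range ((*) (t ^ n)) = right_annihilator t \<inter> range ((*) (t ^ d))"
begin

text \<open>For a generalized inverse \<open>c\<close> of \<open>t ^ Suc n\<close>, the element
  \<open>1 - c * t ^ Suc n\<close> is killed by \<open>t ^ Suc n\<close>, hence by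
  \<open>t ^ n\<close> once the kernels have stabilized; this makes \<open>y = t ^ n * c\<close>
  work.\<close>

lemma left_regular_if_finite_ascent:
  assumes p: "right_annihilator (t ^ p) = right_annihilator (t ^ Suc p)"
  shows "\<exists>n y. n \<ge> d \<and> y * t ^ Suc n = t ^ n"
proof -
  define n where "n = max d p"
  have "Suc n \<ge> d" by (simp add: n_def)
  then obtain c where c: "t ^ Suc n * c * t ^ Suc n = t ^ Suc n" using regular by blast
  have "1 - c * t ^ Suc n \<in> right_annihilator (t ^ Suc n)"
    using c by (simp add: right_annihilator_def right_diff_distrib mult.assoc del: power_Suc)
  also have "right_annihilator (t ^ Suc n) = right_annihilator (t ^ n)"
    using right_annihilator_power_stable[OF p, of "Suc n"] right_annihilator_power_stable[OF p, of n]
    by (simp add: n_def)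
  finally have "t ^ n * c * t ^ Suc n = t ^ n"
    by (simp add: right_annihilator_def right_diff_distrib mult.assoc del: power_Suc)
  then show ?thesis by (intro exI[of _ n] exI[of _ "t ^ n * c"]) (simp add: n_def)
qed

text \<open>The hyperrange of left multiplication by \<open>t\<close>. Exponent 0 contributes the
  whole algebra.\<close>

definition core :: "'a set"
  where "core = (\<Inter>n. range ((*) (t ^ n)))"

lemma core_eq: "core = (\<Inter>n\<in>{d..}. range ((*) (t ^ n)))"
proof
  show "(\<Inter>n\<in>{d..}. range ((*) (t ^ n))) \<subseteq> core"
  proof
    fix a assume a: "a \<in> (\<Inter>n\<in>{d..}. range ((*) (t ^ n)))"
    have "a \<in> range ((*) (t ^ n))" for n
      using a range_power_antimono[of n "max d n" t] by (auto simp del: image_iff)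
    then show "a \<in> core" by (simp add: core_def)
  qed
qed (auto simp: core_def)

lemma in_core_iff: "a \<in> core \<longleftrightarrow> (\<forall>n\<ge>d. a \<in> range ((*) (t ^ n)))"
  unfolding core_eq by blast

text \<open>The range of a regular power with generalized inverse \<open>c\<close> is the fixed
  point set of the continuous left multiplication by \<open>t ^ n * c\<close>.\<close>

lemma closed_core: "closed core"
proof -
  have "closed (range ((*) (t ^ n)))" if n: "n \<ge> d" for n
  proof -
    obtain c where c: "t ^ n * c * t ^ n = t ^ n" using regular[OF n] by blast
    have "range ((*) (t ^ n)) = {a. t ^ n * c * a = a}"
    proof (rule equalityI; rule subsetI)
      fix a assume "a \<in> range ((*) (t ^ n))"
      then obtain b where "a = t ^ n * b" by blast
      then show "a \<in> {a. t ^ n * c * a = a}" using c by (simp add: mult.assoc[symmetric])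
    next
      fix a assume "a \<in> {a. t ^ n * c * a = a}"
      then have "a = t ^ n * (c * a)" by (simp add: mult.assoc)
      then show "a \<in> range ((*) (t ^ n))" by blast
    qed
    moreover have "closed {a. t ^ n * c * a = a}" by (intro closed_Collect_eq continuous_intros)
    ultimately show ?thesis by simp
  qed
  then show ?thesis unfolding core_eq by (intro closed_INT) auto
qed

lemma core_zero: "0 \<in> core"
  unfolding core_def by (auto intro!: image_eqI[of _ _ 0])

lemma core_add: "a \<in> core \<Longrightarrow> b \<in> core \<Longrightarrow> a + b \<in> core"
  unfolding core_def
proof (rule INT_I)
  fix n assume "a \<in> (\<Inter>n. range ((*) (t ^ n)))" "b \<in> (\<Inter>n. range ((*) (t ^ n)))"
  then obtain p q where "a = t ^ n * p" "b = t ^ n * q" by blast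
  then have "a + b = t ^ n * (p + q)" by (simp add: distrib_left)
  then show "a + b \<in> range ((*) (t ^ n))" by blast
qed

lemma core_scaleC: "a \<in> core \<Longrightarrow> c *\<^sub>C a \<in> core"
  unfolding core_def
proof (rule INT_I)
  fix n assume "a \<in> (\<Inter>n. range ((*) (t ^ n)))"
  then obtain p where "a = t ^ n * p" by blast
  then have "c *\<^sub>C a = t ^ n * (c *\<^sub>C p)" by (simp add: mult_scaleC_right)
  then show "c *\<^sub>C a \<in> range ((*) (t ^ n))" by blast
qed

text \<open>Multiplication by \<open>t\<close> maps the core onto itself; regularity of \<open>t ^ Suc d\<close> turns this into
  a bounded right inverse, which replaces the open mapping theorem.\<close>

lemma core_right_inverse: "\<exists>v. \<forall>h\<in>core. v * h \<in> core \<and> t * (v * h) = h"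
proof -
  obtain c where c: "t ^ Suc d * c * t ^ Suc d = t ^ Suc d" using regular[of "Suc d"] by auto
  define v where "v = t ^ d * c"
  have "v * h \<in> core \<and> t * (v * h) = h" if h: "h \<in> core" for h
  proof
    have pre: "\<exists>q. h = t ^ n * q" for n using h by (auto simp: core_def)
    obtain q where q: "h = t ^ Suc d * q" using pre by blast
    have "t * (v * h) = t ^ Suc d * c * t ^ Suc d * q" by (simp add: v_def q mult.assoc)
    then show tvh: "t * (v * h) = h" by (simp only: c q)
    show "v * h \<in> core" unfolding in_core_iff
    proof (intro allI impI)
      fix n assume n: "n \<ge> d"
      \<comment> \<open>A second preimage of \<open>h\<close> under \<open>t\<close> is
        \<open>t ^ n * q\<close>; its difference from \<open>v * h\<close> lies in the kernel of
        \<open>t\<close> and in \<open>t ^ d A\<close>, so stability places it in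
        \<open>t ^ n A\<close>.\<close>
      obtain q where q: "h = t ^ Suc n * q" using pre by blast
      have split: "t ^ n = t ^ d * t ^ (n - d)" using n by (simp add: power_add[symmetric])
      have "v * h - t ^ n * q = t ^ d * (c * h - t ^ (n - d) * q)"
        by (subst split) (simp only: v_def right_diff_distrib mult.assoc)
      moreover have "t * (v * h - t ^ n * q) = 0"
        using tvh q by (simp add: right_diff_distrib mult.assoc)
      ultimately have "v * h - t ^ n * q \<in> right_annihilator t \<inter> range ((*) (t ^ d))"
        by (auto simp: right_annihilator_def)
      then obtain r where "v * h - t ^ n * q = t ^ n * r" using stable[OF n] by blast
      then have "v * h = t ^ n * (r + q)" by (simp add: distrib_left algebra_simps)
      then show "v * h \<in> range ((*) (t ^ n))" by blast
    qed
  qed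
  then show ?thesis by blast
qed

text \<open>A backward orbit exhibits \<open>a\<close> in every range. Conversely the right inverse
  \<open>v\<close> on the core yields the backward orbit \<open>v ^ n * a\<close>, with
  \<open>\<delta> = norm v + 1\<close>, where the 1 ensures positivity.\<close>

lemma left_analytical_core_eq: "left_analytical_core t = core"
proof (rule equalityI; rule subsetI)
  fix a assume "a \<in> left_analytical_core t"
  then obtain s :: "nat \<Rightarrow> 'a" where s: "t * s 1 = a" "\<And>n. n \<ge> 1 \<Longrightarrow> t * s (n + 1) = s n"
    unfolding left_analytical_core_def by blast
  have "t ^ Suc n * s (Suc n) = a" for n
  proof (induction n)
    case (Suc n)
    have "t ^ Suc (Suc n) * s (Suc (Suc n)) = t ^ Suc n * (t * s (Suc n + 1))"
      by (simp only: power_Suc2[of t "Suc n"] mult.assoc Suc_eq_plus1[of "Suc n", symmetric])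
    then show ?case using s(2)[of "Suc n"] Suc by simp
  qed (use s(1) in simp)
  then have "a = t ^ n * (t * s (Suc n))" for n
    by (simp add: power_commutes flip: mult.assoc)
  then show "a \<in> core" unfolding core_def by blast
next
  fix a assume a: "a \<in> core"
  obtain v where v: "\<And>h. h \<in> core \<Longrightarrow> v * h \<in> core" "\<And>h. h \<in> core \<Longrightarrow> t * (v * h) = h"
    using core_right_inverse by blast
  have va: "v ^ n * a \<in> core" for n
    by (induction n) (simp_all add: a v mult.assoc)
  have "t * (v ^ 1 * a) = a" using v(2)[OF a] by simp
  moreover have "t * (v ^ (n + 1) * a) = v ^ n * a" for n
    using v(2)[OF va[of n]] by (simp add: mult.assoc)
  moreover have "norm (v ^ n * a) \<le> (norm v + 1) ^ n * norm a" for n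
  proof -
    have "norm (v ^ n * a) \<le> norm (v ^ n) * norm a" by (rule norm_mult_ineq)
    also have "norm (v ^ n) \<le> norm v ^ n" by (rule norm_power_ineq)
    also have "\<dots> \<le> (norm v + 1) ^ n" by (intro power_mono) auto
    finally show ?thesis by (simp add: mult_right_mono)
  qed
  moreover have "norm v + 1 > 0" by (simp add: add_nonneg_pos)
  ultimately show "a \<in> left_analytical_core t"
    unfolding left_analytical_core_def
    by (intro CollectI exI[of _ "\<lambda>n. v ^ n * a"] exI[of _ "norm v + 1"]) blast
qed

text \<open>If \<open>a = t ^ p * b\<close> is annihilated by \<open>t ^ p\<close>, then
  \<open>t ^ (p + p) * b = 0\<close>, and stability of the kernels already gives
  \<open>t ^ p * b = 0\<close>.\<close>

lemma annihilator_Int_core: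
  assumes p: "right_annihilator (t ^ p) = right_annihilator (t ^ Suc p)"
  shows "right_annihilator (t ^ p) \<inter> core = {0}"
proof -
  have "a = 0" if ann: "a \<in> right_annihilator (t ^ p)" and core: "a \<in> core" for a
  proof -
    obtain b where b: "a = t ^ p * b" using core by (auto simp: core_def)
    then have "b \<in> right_annihilator (t ^ (p + p))"
      using ann by (simp add: right_annihilator_def power_add mult.assoc)
    then have "b \<in> right_annihilator (t ^ p)"
      using right_annihilator_power_stable[OF p, of "p + p"] by simp
    then show ?thesis using b by (simp add: right_annihilator_def)
  qed
  then show ?thesis using core_zero by (auto simp: right_annihilator_def)
qed

text \<open>Strict growth of the kernels at exponent \<open>d\<close> yields a nonzero
  \<open>a\<close> in the kernel of \<open>t\<close> and in \<open>t ^ d A\<close>, which stability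
  moves into the core. The approximating sequences are recorded for the closedness
  arguments.\<close>

lemma eigenvector_family:
  assumes inf: "\<And>n. right_annihilator (t ^ n) \<noteq> right_annihilator (t ^ Suc n)"
  obtains r H where "r > 0" "banach_holomorphic_on H (ball 0 r)"
    "\<forall>\<mu>\<in>ball 0 r. H \<mu> \<noteq> 0 \<and> t * H \<mu> = \<mu> *\<^sub>C H \<mu> \<and>
      (\<exists>s. s \<longlonglongrightarrow> H \<mu> \<and> (\<forall>m. s m \<in> right_annihilator (t ^ m) \<inter> core))"
    "H 0 \<in> right_annihilator t \<inter> core"
proof -
  obtain b where b: "t ^ Suc d * b = 0" "t ^ d * b \<noteq> 0"
    using inf[of d] right_annihilator_power_mono[of d "Suc d" t] by (auto simp: right_annihilator_def)
  define a where "a = t ^ d * b"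
  have ta: "t * a = 0" and a0: "a \<noteq> 0" using b by (simp_all add: a_def mult.assoc)
  have a: "a \<in> core" unfolding in_core_iff
  proof (intro allI impI)
    fix n assume "n \<ge> d"
    moreover have "a \<in> right_annihilator t \<inter> range ((*) (t ^ d))"
      using ta by (auto simp: right_annihilator_def a_def)
    ultimately show "a \<in> range ((*) (t ^ n))" using stable[of n] by blast
  qed
  obtain v where v: "\<And>h. h \<in> core \<Longrightarrow> v * h \<in> core" "\<And>h. h \<in> core \<Longrightarrow> t * (v * h) = h"
    using core_right_inverse by blast
  have va: "v ^ n * a \<in> core" for n
    by (induction n) (simp_all add: a v mult.assoc)
  have tva: "t ^ n * (v ^ n * a) = a" for n
  proof (induction n)
    case (Suc n)
    have "t ^ Suc n * (v ^ Suc n * a) = t ^ n * (t * (v * (v ^ n * a)))"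
      by (simp add: power_Suc2[of t] mult.assoc del: power_Suc) (simp add: mult.assoc)
    then show ?case using v(2)[OF va[of n]] Suc by simp
  qed simp
  \<comment> \<open>This radius keeps the norm of \<open>\<mu> *\<^sub>C v\<close> at most 1/2, so
    the inverses \<open>G \<mu>\<close> are uniformly bounded by 2.\<close>
  define r where "r = 1 / (2 * (norm v + 1))"
  have r: "r > 0" by (simp add: r_def add_nonneg_pos)
  define G where "G \<mu> = neumann (\<mu> *\<^sub>C v)" for \<mu>
  define H where "H \<mu> = G \<mu> * a" for \<mu>
  have half: "norm (\<mu> *\<^sub>C v) \<le> 1 / 2" if "\<mu> \<in> ball 0 r" for \<mu>
  proof -
    have "cmod \<mu> * norm v \<le> r * (norm v + 1)" using that r by (intro mult_mono) auto
    also have "\<dots> = 1 / 2" using add_nonneg_pos[of "norm v" 1] by (simp add: r_def field_simps)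
    finally show ?thesis by (simp add: norm_scaleC)
  qed
  have small: "norm (\<mu> *\<^sub>C v) < 1" if "\<mu> \<in> ball 0 r" for \<mu>
    using half[OF that] by simp
  have G: "(1 - \<mu> *\<^sub>C v) * G \<mu> = 1" "G \<mu> * (1 - \<mu> *\<^sub>C v) = 1" if "\<mu> \<in> ball 0 r" for \<mu>
    unfolding G_def by (rule neumann_right[OF small[OF that]], rule neumann_left[OF small[OF that]])
  have G2: "norm (G \<mu>) \<le> 2" if "\<mu> \<in> ball 0 r" for \<mu>
  proof -
    have "norm (G \<mu>) \<le> 1 / (1 - norm (\<mu> *\<^sub>C v))" unfolding G_def by (rule norm_neumann_le[OF small[OF that]])
    also have "\<dots> \<le> 1 / (1 / 2)" using half[OF that] by (intro divide_left_mono) auto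
    finally show ?thesis by simp
  qed
  have seq: "\<exists>s. s \<longlonglongrightarrow> H \<mu> \<and> (\<forall>m. s m \<in> right_annihilator (t ^ m) \<inter> core)" if "\<mu> \<in> ball 0 r" for \<mu>
  proof (intro exI conjI allI)
    define s where "s m = (\<Sum>n<m. (\<mu> *\<^sub>C v) ^ n * a)" for m
    show "s \<longlonglongrightarrow> H \<mu>"
      using sums_mult2[OF neumann_sums[OF small[OF that]], of a] unfolding s_def H_def G_def sums_def .
    fix m
    have pow: "(\<mu> *\<^sub>C v) ^ n = (\<mu> ^ n) *\<^sub>C v ^ n" for n
      by (induction n) (simp_all add: mult_scaleC_left mult_scaleC_right scaleC_scaleC mult.commute)
    \<comment> \<open>The first \<open>n\<close> factors \<open>t\<close> undo \<open>v ^ n\<close>,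
      and one more kills \<open>a\<close>.\<close>
    have "t ^ m * (v ^ n * a) = 0" if "n < m" for n
    proof -
      have "t ^ m = t ^ (m - Suc n) * t * t ^ n"
        using that by (simp add: power_Suc2[symmetric] power_add[symmetric] del: power_Suc)
      then have "t ^ m * (v ^ n * a) = t ^ (m - Suc n) * (t * (t ^ n * (v ^ n * a)))"
        by (simp only: mult.assoc)
      then show ?thesis by (simp add: tva ta)
    qed
    then have "t ^ m * s m = 0"
      by (simp add: s_def sum_distrib_left pow mult_scaleC_left mult_scaleC_right)
    moreover have "s m \<in> core"
      unfolding s_def by (induction m) (simp_all add: core_zero core_add core_scaleC va pow mult_scaleC_left)
    ultimately show "s m \<in> right_annihilator (t ^ m) \<inter> core" by (simp add: right_annihilator_def)
  qed
  \<comment> \<open>Closedness carries the limit into the core, where \<open>v\<close> is known to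
    be a right inverse of \<open>t\<close>.\<close>
  have core: "H \<mu> \<in> core" if "\<mu> \<in> ball 0 r" for \<mu>
    using seq[OF that] closed_core by (auto intro: closed_sequentially)
  have "t * H \<mu> = \<mu> *\<^sub>C H \<mu>" if "\<mu> \<in> ball 0 r" for \<mu>
  proof -
    have "(1 - \<mu> *\<^sub>C v) * H \<mu> = a" by (simp add: H_def G[OF that] flip: mult.assoc)
    then have "H \<mu> = a + \<mu> *\<^sub>C (v * H \<mu>)" by (simp add: left_diff_distrib mult_scaleC_left algebra_simps)
    then have "t * H \<mu> = t * (a + \<mu> *\<^sub>C (v * H \<mu>))" by simp
    also have "\<dots> = \<mu> *\<^sub>C (t * (v * H \<mu>))" by (simp add: distrib_left ta mult_scaleC_right)
    also have "t * (v * H \<mu>) = H \<mu>" by (rule v(2)[OF core[OF that]])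
    finally show ?thesis .
  qed
  moreover have "H \<mu> \<noteq> 0" if "\<mu> \<in> ball 0 r" for \<mu>
  proof
    assume "H \<mu> = 0"
    then have "(1 - \<mu> *\<^sub>C v) * G \<mu> * a = 0" by (simp add: H_def mult.assoc)
    then show False using G[OF that] a0 by simp
  qed
  moreover have "banach_holomorphic_on H (ball 0 r)"
    unfolding banach_holomorphic_on_def
  proof
    fix z :: complex assume z: "z \<in> ball 0 r"
    \<comment> \<open>The resolvent identity, used both for the continuity of \<open>G\<close> and
      for the derivative of \<open>H\<close>.\<close>
    have res: "G w - G z = (w - z) *\<^sub>C (G w * v * G z)" if w: "w \<in> ball 0 r" for w
    proof -
      have "(w - z) *\<^sub>C (G w * v * G z) = G w * ((1 - z *\<^sub>C v) - (1 - w *\<^sub>C v)) * G z"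
        by (simp add: scaleC_diff_left right_diff_distrib left_diff_distrib mult_scaleC_left mult_scaleC_right)
      also have "\<dots> = G w * ((1 - z *\<^sub>C v) * G z) - (G w * (1 - w *\<^sub>C v)) * G z"
        by (simp only: right_diff_distrib[of "G w"] left_diff_distrib[of _ _ "G z"] mult.assoc)
      finally show ?thesis by (simp only: G[OF w] G[OF z] mult_1_left mult_1_right)
    qed
    define D where "D = G z * v * G z * a"
    have "(H has_derivative (\<lambda>h. h *\<^sub>C D)) (at z within ball 0 r)"
    proof (rule has_derivativeI_sandwich[of 1])
      show "bounded_linear (\<lambda>h. h *\<^sub>C D)"
      proof (rule bounded_linear_intro)
        show "norm (h *\<^sub>C D) \<le> norm h * norm D" for h by (simp add: norm_scaleC)
      qed (simp_all add: scaleC_add_left scaleR_scaleC[where 'a = 'a] scaleC_scaleC scaleR_conv_of_real)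
      \<comment> \<open>The bounds on \<open>G w\<close> and \<open>G z\<close> contribute a factor
        2 each.\<close>
      define K where "K = 4 * norm v * norm (v * G z * a)"
      have "((\<lambda>y. K * norm (y - z)) \<longlongrightarrow> K * norm (z - z)) (at z within ball 0 r)"
        by (intro tendsto_intros)
      then show "((\<lambda>y. K * norm (y - z)) \<longlongrightarrow> 0) (at z within ball 0 r)" by simp
      fix w assume w: "w \<in> ball 0 r" "w \<noteq> z"
      have "H w - H z = (w - z) *\<^sub>C (G w * (v * G z * a))"
        by (simp add: H_def left_diff_distrib[symmetric] res[OF w(1)] mult_scaleC_left mult.assoc)
      then have "H w - H z - (w - z) *\<^sub>C D = (w - z) *\<^sub>C ((G w - G z) * (v * G z * a))"
        by (simp add: D_def left_diff_distrib scaleC_diff_right mult.assoc)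
      also have "norm \<dots> = cmod (w - z) * norm ((G w - G z) * (v * G z * a))"
        by (rule norm_scaleC)
      also have "\<dots> \<le> cmod (w - z) * (norm (G w - G z) * norm (v * G z * a))"
        by (intro mult_left_mono norm_mult_ineq) simp
      also have "\<dots> \<le> cmod (w - z) * ((cmod (w - z) * (2 * norm v * 2)) * norm (v * G z * a))"
        using w(1) z unfolding res[OF w(1)] norm_scaleC
        by (intro mult_left_mono mult_right_mono order_trans[OF norm_mult_ineq] mult_mono G2) auto
      finally show "norm (H w - H z - (w - z) *\<^sub>C D) / norm (w - z) \<le> K * norm (w - z)"
        using w(2) by (simp add: K_def divide_le_eq mult_ac)
    qed simp
    then show "\<exists>D. (H has_derivative (\<lambda>h. h *\<^sub>C D)) (at z within ball 0 r)" ..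
  qed
  moreover have "H 0 = a"
    using G(1)[of 0] r by (simp add: H_def)
  ultimately show ?thesis using that[of r H] r seq ta a by (simp add: right_annihilator_def)
qed

end

text \<open>Left inverses force \<open>f\<close> to vanish on a punctured neighbourhood of
  \<open>l0\<close>, and the identity theorem spreads this over the connected set
  \<open>U\<close>.\<close>

lemma left_SVEP_if_left_invertible_near:
  fixes x :: "'a::complex_banach_algebra_1"
  assumes \<epsilon>: "\<epsilon> > 0"
    and inv: "\<And>\<mu>. \<mu> \<noteq> 0 \<Longrightarrow> cmod \<mu> < \<epsilon> \<Longrightarrow> \<exists>z. z * (x - l0 *\<^sub>C 1 - \<mu> *\<^sub>C 1) = 1"
  shows "left_SVEP x l0"
  unfolding left_SVEP_def
proof (intro allI impI ballI)
  fix U f z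
  assume U: "open U" "connected U" "l0 \<in> U" and hol: "banach_holomorphic_on f U"
    and ker: "\<forall>\<mu>\<in>U. (\<mu> *\<^sub>C 1 - x) * f \<mu> = 0" and z: "z \<in> U"
  define V where "V = (U \<inter> ball l0 \<epsilon>) - {l0}"
  have "f w = 0" if w: "w \<in> V" for w
  proof -
    have "w - l0 \<noteq> 0" "cmod (w - l0) < \<epsilon>"
      using w by (auto simp: V_def dist_norm norm_minus_commute)
    then obtain y where y: "y * (x - l0 *\<^sub>C 1 - (w - l0) *\<^sub>C 1) = 1" using inv by blast
    have "x - l0 *\<^sub>C 1 - (w - l0) *\<^sub>C 1 = - (w *\<^sub>C 1 - x)" by (simp add: scaleC_diff_left)
    then have "f w = y * (- (w *\<^sub>C 1 - x)) * f w" using y by (simp only: mult_1_left)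
    also have "\<dots> = - (y * ((w *\<^sub>C 1 - x) * f w))"
      by (simp only: mult_minus_right mult_minus_left mult.assoc)
    also have "(w *\<^sub>C 1 - x) * f w = 0" using w ker unfolding V_def by blast
    finally show ?thesis by simp
  qed
  moreover have "open V" using U(1) by (simp add: V_def open_Int open_delete)
  moreover have "V \<noteq> {}"
  proof
    assume "V = {}"
    \<comment> \<open>Otherwise the singleton \<open>{l0}\<close> would be open.\<close>
    then have "U \<inter> ball l0 \<epsilon> = {l0}" using U(3) \<epsilon> by (auto simp: V_def)
    then show False using U(1) not_open_singleton[of l0] by (metis open_Int open_ball)
  qed
  moreover have "V \<subseteq> U" by (auto simp: V_def)
  ultimately show "f z = 0" using banach_identity_theorem[OF U(1,2) hol] z by blast
qed

lemma closed_right_annihilator: "closed (right_annihilator a)"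
  unfolding right_annihilator_def by (intro closed_Collect_eq continuous_intros)

text \<open>Since \<open>t ^ n\<close> acts on \<open>h\<close> as the scalar
  \<open>\<mu> ^ n\<close>, the roots of the norms converge to \<open>cmod \<mu>\<close> instead of
  0.\<close>

lemma eigenvector_not_quasinilpotent:
  assumes eig: "t * h = \<mu> *\<^sub>C h" and "h \<noteq> 0" "\<mu> \<noteq> 0"
  shows "h \<notin> left_quasinilpotent_part t"
proof
  assume "h \<in> left_quasinilpotent_part t"
  then have lim: "(\<lambda>n. root n (norm (t ^ n * h))) \<longlonglongrightarrow> 0" by (simp add: left_quasinilpotent_part_def)
  have pow: "t ^ n * h = \<mu> ^ n *\<^sub>C h" for n
    by (induction n) (simp_all add: mult.assoc mult_scaleC_right eig scaleC_scaleC mult.commute)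
  have "\<forall>\<^sub>F n in sequentially. cmod \<mu> * root n (norm h) = root n (norm (t ^ n * h))"
    using eventually_gt_at_top[of 0]
    by eventually_elim (simp add: pow norm_scaleC norm_power real_root_mult real_root_power_cancel)
  moreover have "(\<lambda>n. cmod \<mu> * root n (norm h)) \<longlonglongrightarrow> cmod \<mu> * 1"
    using assms(2) by (intro tendsto_intros LIMSEQ_root_const) simp
  ultimately have "(\<lambda>n. root n (norm (t ^ n * h))) \<longlonglongrightarrow> cmod \<mu> * 1"
    by (rule Lim_transform_eventually[rotated])
  then have "cmod \<mu> * 1 = 0" by (rule LIMSEQ_unique[OF _ lim])
  then show False using assms(3) by simp
qed

section \<open>Equivalence of the ten conditions\<close>

theorem theorem3p4:
  fixes x :: "'a::complex_banach_algebra_1" and l0 :: complex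
  assumes "semiprime (algebra_ring :: 'a ring)"
    and "socle (algebra_ring :: 'a ring) \<noteq> {0}"
    and "B_Fredholm (x - l0 *\<^sub>C 1)"
  shows
    "(left_SVEP x l0 \<longleftrightarrow> left_ascent (x - l0 *\<^sub>C 1) < \<infinity>) \<and>
     (left_SVEP x l0 \<longleftrightarrow> right_descent (x - l0 *\<^sub>C 1) < \<infinity>) \<and>
     (left_SVEP x l0 \<longleftrightarrow> \<not> l0 islimpt left_spectrum x) \<and>
     (left_SVEP x l0 \<longleftrightarrow> l0 \<notin> interior (left_spectrum x)) \<and>
     (left_SVEP x l0 \<longleftrightarrow>
       (\<exists>p::nat. left_quasinilpotent_part (x - l0 *\<^sub>C 1) = right_annihilator ((x - l0 *\<^sub>C 1) ^ p))) \<and>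
     (left_SVEP x l0 \<longleftrightarrow> closed (left_quasinilpotent_part (x - l0 *\<^sub>C 1))) \<and>
     (left_SVEP x l0 \<longleftrightarrow>
       left_quasinilpotent_part (x - l0 *\<^sub>C 1) \<inter> left_analytical_core (x - l0 *\<^sub>C 1) = {0}) \<and>
     (left_SVEP x l0 \<longleftrightarrow>
       closed (left_quasinilpotent_part (x - l0 *\<^sub>C 1) \<inter> left_analytical_core (x - l0 *\<^sub>C 1))) \<and>
     (left_SVEP x l0 \<longleftrightarrow>
       (\<Union>n\<in>{1::nat..}. right_annihilator ((x - l0 *\<^sub>C 1) ^ n)) \<inter>
       (\<Inter>n\<in>{1::nat..}. range (\<lambda>a. (x - l0 *\<^sub>C 1) ^ n * a)) = {0}) \<and>
     (left_SVEP x l0 \<longrightarrow>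
       (\<exists>p::nat. left_ascent (x - l0 *\<^sub>C 1) = enat p \<and>
         left_quasinilpotent_part (x - l0 *\<^sub>C 1) =
           (\<Union>n\<in>{1::nat..}. right_annihilator ((x - l0 *\<^sub>C 1) ^ n)) \<and>
         (\<Union>n\<in>{1::nat..}. right_annihilator ((x - l0 *\<^sub>C 1) ^ n)) =
           right_annihilator ((x - l0 *\<^sub>C 1) ^ p)))"
proof -
  define t where "t = x - l0 *\<^sub>C 1"
  obtain d where d: "\<And>n. n \<ge> d \<Longrightarrow> \<exists>c. t ^ n * c * t ^ n = t ^ n"
    "\<And>n. n \<ge> d \<Longrightarrow> right_annihilator t \<inter> range ((*) (t ^ n)) = right_annihilator t \<inter> range ((*) (t ^ d))"
    using B_Fredholm_regular_stable[OF assms(1,3)] unfolding t_def by blast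
  interpret stably_regular t d by unfold_locales (fact d)+
  have inter: "(\<Inter>n\<in>{1::nat..}. range (\<lambda>a. t ^ n * a)) = core"
  proof
    show "(\<Inter>n\<in>{1::nat..}. range (\<lambda>a. t ^ n * a)) \<subseteq> core"
    proof
      fix a assume "a \<in> (\<Inter>n\<in>{1::nat..}. range (\<lambda>a. t ^ n * a))"
      then have "a \<in> range ((*) (t ^ Suc n))" for n by (rule INT_D) simp
      then have "a \<in> range ((*) (t ^ n))" for n using range_power_antimono[of n "Suc n" t] by auto
      then show "a \<in> core" by (simp add: core_def)
    qed
  qed (auto simp: core_def)
  have spec: "l \<in> left_spectrum x \<longleftrightarrow> \<not> (\<exists>y. y * (t - (l - l0) *\<^sub>C 1) = 1)" for l
    by (simp add: left_spectrum_def t_def scaleC_diff_left)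
  show ?thesis
  \<comment> \<open>Every condition is shown to hold when the ascent is finite and to fail
    otherwise, which gives all equivalences at once.\<close>
  proof (cases "\<exists>n. right_annihilator (t ^ n) = right_annihilator (t ^ Suc n)")
    case True
    note ascent = left_ascent_eq[of t] Inf_enat_Collect[of "\<lambda>n. right_annihilator (t ^ n) = right_annihilator (t ^ Suc n)"]
    obtain p where p: "left_ascent t = enat p" "right_annihilator (t ^ p) = right_annihilator (t ^ Suc p)"
      using ascent(1) ascent(3)[OF True] by auto
    obtain n y where y: "n \<ge> d" "y * t ^ Suc n = t ^ n"
      using left_regular_if_finite_ascent[OF p(2)] by blast
    obtain c where c: "t ^ n * c * t ^ n = t ^ n" using d(1)[OF y(1)] by blast
    obtain \<epsilon> where \<epsilon>: "\<epsilon> > 0" "\<And>\<mu>. \<mu> \<noteq> 0 \<Longrightarrow> cmod \<mu> < \<epsilon> \<Longrightarrow> \<exists>z. z * (t - \<mu> *\<^sub>C 1) = 1"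
      using left_invertible_near[OF y(2) c] by blast
    note H = quasinilpotent_part_eq[OF y(2) p(2)] and U = Union_right_annihilator_power[OF p(2)]
    have 1: "left_SVEP x l0"
      using left_SVEP_if_left_invertible_near[of \<epsilon> x l0] \<epsilon> unfolding t_def by blast
    have 2: "left_ascent t < \<infinity>" by (simp add: p(1))
    have 3: "right_descent t < \<infinity>"
      unfolding right_descent_eq Inf_enat_Collect(1) using y(2) by blast
    have 4: "\<not> l0 islimpt left_spectrum x"
    proof -
      have "l \<notin> left_spectrum x" if "l \<in> ball l0 \<epsilon>" "l \<noteq> l0" for l
        using \<epsilon>(2)[of "l - l0"] that by (simp add: spec dist_norm norm_minus_commute)
      then show ?thesis unfolding islimpt_def using \<epsilon>(1) by (metis centre_in_ball open_ball)
    qed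
    then have 5: "l0 \<notin> interior (left_spectrum x)" using interior_limit_point by blast
    have 6: "\<exists>p. left_quasinilpotent_part t = right_annihilator (t ^ p)" using H by blast
    have 7: "closed (left_quasinilpotent_part t)" by (simp add: H closed_right_annihilator)
    have 8: "left_quasinilpotent_part t \<inter> core = {0}" by (simp only: H annihilator_Int_core[OF p(2)])
    have 9: "closed (left_quasinilpotent_part t \<inter> core)" by (simp add: 8)
    have 10: "(\<Union>n\<in>{1::nat..}. right_annihilator (t ^ n)) \<inter> core = {0}"
      by (simp only: U annihilator_Int_core[OF p(2)])
    have 11: "\<exists>p. left_ascent t = enat p \<and>
        left_quasinilpotent_part t = (\<Union>n\<in>{1::nat..}. right_annihilator (t ^ n)) \<and>
        (\<Union>n\<in>{1::nat..}. right_annihilator (t ^ n)) = right_annihilator (t ^ p)"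
      using p(1) by (intro exI[of _ p] conjI) (simp_all only: H U)
    show ?thesis
      unfolding t_def[symmetric] left_analytical_core_eq inter
      by (intro conjI iffI impI 1 2 3 4 5 6 7 8 9 10 11)
  next
    case False
    then have inf: "right_annihilator (t ^ n) \<noteq> right_annihilator (t ^ Suc n)" for n by blast
    obtain r H where r: "r > 0" and hol: "banach_holomorphic_on H (ball 0 r)"
      and H: "\<forall>\<mu>\<in>ball 0 r. H \<mu> \<noteq> 0 \<and> t * H \<mu> = \<mu> *\<^sub>C H \<mu> \<and>
        (\<exists>s. s \<longlonglongrightarrow> H \<mu> \<and> (\<forall>m. s m \<in> right_annihilator (t ^ m) \<inter> core))"
      and H0: "H 0 \<in> right_annihilator t \<inter> core"
      by (rule eigenvector_family[OF inf])
    have nz: "H \<mu> \<noteq> 0" and eig: "t * H \<mu> = \<mu> *\<^sub>C H \<mu>"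
      and lim: "\<exists>s. s \<longlonglongrightarrow> H \<mu> \<and> (\<forall>m. s m \<in> right_annihilator (t ^ m) \<inter> core)"
      if "\<mu> \<in> ball 0 r" for \<mu>
      using H that by simp_all
    have shift: "l - l0 \<in> ball 0 r" if "l \<in> ball l0 r" for l
      using that by (simp add: dist_norm norm_minus_commute)
    have kernel: "(t - (l - l0) *\<^sub>C 1) * H (l - l0) = 0" if "l \<in> ball l0 r" for l
      using eig[OF shift[OF that]] by (simp add: left_diff_distrib)
    have 1: "\<not> left_SVEP x l0"
    proof
      assume svep: "left_SVEP x l0"
      \<comment> \<open>The translated eigenvector family is the witness against SVEP; it does not
        vanish at \<open>l0\<close>.\<close>
      have "banach_holomorphic_on (\<lambda>z. H (z - l0)) (ball l0 r)"
        unfolding banach_holomorphic_on_def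
      proof
        fix z assume z: "z \<in> ball l0 r"
        obtain D where D: "(H has_derivative (\<lambda>h. h *\<^sub>C D)) (at (z - l0) within ball 0 r)"
          using hol shift[OF z] unfolding banach_holomorphic_on_def by blast
        have sub: "(\<lambda>z. z - l0) ` ball l0 r \<subseteq> ball 0 r" using shift by blast
        have "((\<lambda>z. z - l0) has_derivative (\<lambda>h. h)) (at z within ball l0 r)"
          by (auto intro!: derivative_eq_intros)
        from has_derivative_in_compose[OF this has_derivative_subset[OF D sub]]
        have "((\<lambda>z. H (z - l0)) has_derivative (\<lambda>h. h *\<^sub>C D)) (at z within ball l0 r)" .
        then show "\<exists>D. ((\<lambda>z. H (z - l0)) has_derivative (\<lambda>h. h *\<^sub>C D)) (at z within ball l0 r)" ..
      qed
      moreover have "(\<mu> *\<^sub>C 1 - x) * H (\<mu> - l0) = 0" if "\<mu> \<in> ball l0 r" for \<mu>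
        using kernel[OF that] by (simp add: t_def left_diff_distrib scaleC_diff_left)
      ultimately have "H (\<mu> - l0) = 0" if "\<mu> \<in> ball l0 r" for \<mu>
        using svep that r unfolding left_SVEP_def
        by (metis (no_types, lifting) centre_in_ball connected_ball open_ball)
      from this[of l0] show False using nz[of 0] r by simp
    qed
    have 2: "\<not> left_ascent t < \<infinity>"
      unfolding left_ascent_eq Inf_enat_Collect(1) using False .
    have 3: "\<not> right_descent t < \<infinity>"
      unfolding right_descent_eq Inf_enat_Collect(1)
      using False right_annihilator_power_eq_if_left_regular by blast
    have "ball l0 r \<subseteq> left_spectrum x"
    proof
      fix l assume l_in: "l \<in> ball l0 r"
      have "False" if "y * (t - (l - l0) *\<^sub>C 1) = 1" for y
      proof -
        have "H (l - l0) = y * ((t - (l - l0) *\<^sub>C 1) * H (l - l0))"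
          using that by (simp only: mult.assoc[symmetric] mult_1_left)
        then show False using kernel[OF l_in] nz[OF shift[OF l_in]] by simp
      qed
      then show "l \<in> left_spectrum x" unfolding spec by blast
    qed
    then have interior: "l0 \<in> interior (left_spectrum x)"
      using r by (meson centre_in_ball interiorI open_ball)
    then have 4: "\<not> \<not> l0 islimpt left_spectrum x" using interior_limit_point by blast
    have 5: "\<not> l0 \<notin> interior (left_spectrum x)" using interior by simp
    \<comment> \<open>This comes before 8, 7 and 6 because their failure follows from it:
      singletons, the core and annihilators are closed.\<close>
    have 9: "\<not> closed (left_quasinilpotent_part t \<inter> core)"
    proof
      assume closed: "closed (left_quasinilpotent_part t \<inter> core)"
      \<comment> \<open>Any nonzero point of the disc would serve: \<open>H \<mu>\<close> is a limit
        of elements of the intersection, yet an eigenvector for a nonzero eigenvalue.\<close>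
      define \<mu> where "\<mu> = complex_of_real (r / 2)"
      have \<mu>: "\<mu> \<in> ball 0 r" "\<mu> \<noteq> 0" using r by (simp_all add: \<mu>_def)
      obtain s where s: "s \<longlonglongrightarrow> H \<mu>" "\<And>m. s m \<in> right_annihilator (t ^ m) \<inter> core"
        using lim[OF \<mu>(1)] by blast
      have "s m \<in> left_quasinilpotent_part t \<inter> core" for m
        using s(2)[of m] right_annihilator_subset_quasinilpotent[of t m] by blast
      then have "H \<mu> \<in> left_quasinilpotent_part t \<inter> core"
        using closed s(1) closed_sequentially by blast
      then show False
        using eigenvector_not_quasinilpotent[OF eig[OF \<mu>(1)] nz[OF \<mu>(1)] \<mu>(2)] by blast
    qed
    then have 8: "left_quasinilpotent_part t \<inter> core \<noteq> {0}" using closed_singleton[of 0] by metis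
    have 7: "\<not> closed (left_quasinilpotent_part t)"
      using 9 closed_Int[OF _ closed_core] by blast
    then have 6: "\<not> (\<exists>p. left_quasinilpotent_part t = right_annihilator (t ^ p))"
      using closed_right_annihilator by metis
    have 10: "(\<Union>n\<in>{1::nat..}. right_annihilator (t ^ n)) \<inter> core \<noteq> {0}"
    proof -
      have "H 0 \<in> (\<Union>n\<in>{1::nat..}. right_annihilator (t ^ n))"
        using H0 by (intro UN_I[of 1]) auto
      moreover have "H 0 \<noteq> 0" using nz[of 0] r by simp
      ultimately show ?thesis using H0 by blast
    qed
    show ?thesis
      unfolding t_def[symmetric] left_analytical_core_eq inter
      by (intro conjI iffI impI)
        (erule notE[OF 1] notE[OF 2] notE[OF 3] notE[OF 4] notE[OF 5] notE[OF 6] notE[OF 7]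
          notE[OF 8] notE[OF 9] notE[OF 10])+
  qed
qed

end
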